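(* Let $X$ be a finite connected simplicial complex with $|V(X)|=m$, and let $\mathbb{F}$ be the field with two elements. Then the poset homology of the Boolean poset $B(m)$ with coefficients in the functor $\mathcal{H}\colon \mathbf{B}(m)\to\mathbf{Mod}_{\mathbb{F}}$, $\mathcal{H}(b)=\mathrm{H}^h(X,\varepsilon_b;\mathbb{F})$, agrees with the überhomology $\ddot{\mathrm{H}}^*(X)$ of $X$ with coefficients in $\mathbb{F}$.
   Context: Horizontal homology. Order $V(X)=\{v_1,\dots,v_m\}$. A bi-colouring on $X$ is a map $\varepsilon\colon V(X)\to\{0,1\}$; put $\ell(\varepsilon)=\sum_j\varepsilon(v_j)$. For a simplex $\sigma$, the weight $w_\varepsilon(\sigma)=\dim(\sigma)+1-\sum_{v\in V(\sigma)}\varepsilon(v)$ is the number of its $0$-coloured vertices. The simplicial differential on $C_*(X;\mathbb{F})$ is the sum of a part $\partial_h$ preserving $w_\varepsilon$ and a part decreasing $w_\varepsilon$ by one; $\mathrm{H}^h(X,\varepsilon;\mathbb{F})$ is the homology of $(C_*(X;\mathbb{F}),\partial_h)$. If $\varepsilon'$ is obtained from $\varepsilon$ by changing the value at exactly one vertex from $0$ to $1$, then $d_{\varepsilon,\varepsilon'}\colon\mathrm{H}^h(X,\varepsilon;\mathbb{F})\to\mathrm{H}^h(X,\varepsilon';\mathbb{F})$ is induced by $\sigma\mapsto\sigma$ if $w_\varepsilon(\sigma)=w_{\varepsilon'}(\sigma)$, and $\sigma\mapsto 0$ otherwise. Überhomology over $\mathbb{F}$. $\ddot{\mathrm{C}}^j(X;\mathbb{F})=\bigoplus_{\ell(\varepsilon)=j}\mathrm{H}^h(X,\varepsilon;\mathbb{F})$,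 with differential $d^j=\sum d_{\varepsilon,\varepsilon'}$ over all pairs $(\varepsilon,\varepsilon')$ of bi-colourings on $X$ such that $\varepsilon'$ is obtained from $\varepsilon$ by changing the value at exactly one vertex from $0$ to $1$, with $\ell(\varepsilon)=j$; $\ddot{\mathrm{H}}^*(X)$ is its homology. Poset homology. Let $P$ be a finite poset with rank function $\ell$ (increasing by $1$ along covering relations $x\,\widetilde{\triangleleft}\,y$) which is squared: whenever $z$ covers $y$ and $y$ covers $x$ there is a unique $y'\neq y$ such that $z$ covers $y'$ and $y'$ covers $x$. Let $\mathbf{P}$ be the associated category (one morphism $x\to y$ iff $x\le y$). A sign assignment is a choice of $s(x,y)\in\mathbb{Z}/2$ for each covering relation with $s(x,y)+s(y,z)\equiv s(x,y')+s(y',z)+1\pmod 2$ on every such square. For a covariant functor $\mathcal{F}\colon\mathbf{P}\to\mathbf{A}$ to an Abelian category, the poset homology of $P$ with coefficients in $\mathcal{F}$ is the homology of $C^n_{\mathcal{F}}(P)=\bigoplus_{\ell(x)=n}\mathcal{F}(x)$ with $d^n=\sum_{\ell(x)=n}\sum_{x\,\widetilde{\triangleleft}\,x'}(-1)^{s(x,x')}\mathcal{F}(x\,\widetilde{\triangleleft}\,x')$. The Boolean poset $B(m)$ of subsets of $\{1,\dots,m\}$ (rank = cardinality) is ranked and squared, admits a sign assignment, and the choice is immaterial up to isomorphism. The functor $\mathcal{H}$. An element $b\in B(m)$ is identified with the bi-colouring $\varepsilon_b$ with $\varepsilon_b(v_i)=1$ iff $i\in b$. $\mathcal{H}(b)=\mathrm{H}^h(X,\varepsilon_b;\mathbb{F})$,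 $\mathcal{H}(b\,\widetilde{\triangleleft}\,b')=d_{\varepsilon_b,\varepsilon_{b'}}$ on covering relations, extended to all morphisms by composition. *)

theory Defs
  imports "HOL-Algebra.Module" "HOL-Algebra.AbelCoset" "HOL-Library.Z2"
begin

section \<open>Modules\<close>

definition module_hom ::
    "('r, 'x) ring_scheme \<Rightarrow> ('r, 'a, 'y) module_scheme \<Rightarrow> ('r, 'b, 'z) module_scheme \<Rightarrow> ('a \<Rightarrow> 'b) set" where
  "module_hom R M N =
    {f \<in> carrier M \<rightarrow> carrier N.
      (\<forall>x \<in> carrier M. \<forall>y \<in> carrier M. f (x \<oplus>\<^bsub>M\<^esub> y) = f x \<oplus>\<^bsub>N\<^esub> f y) \<and>
      (\<forall>a \<in> carrier R. \<forall>x \<in> carrier M. f (a \<odot>\<^bsub>M\<^esub> x) = a \<odot>\<^bsub>N\<^esub> f x)}"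

definition module_isomorphic ::
    "('r, 'x) ring_scheme \<Rightarrow> ('r, 'a, 'y) module_scheme \<Rightarrow> ('r, 'b, 'z) module_scheme \<Rightarrow> bool" where
  "module_isomorphic R M N \<longleftrightarrow>
    module R M \<and> module R N \<and> (\<exists>f \<in> module_hom R M N. bij_betw f (carrier M) (carrier N))"

text \<open>The multiplicative fields that the record \<^typ>\<open>('r, 'a) module\<close> inherits from rings play no
  role for a module and are left unspecified below.\<close>

definition ring_as_module :: "('r, 'x) ring_scheme \<Rightarrow> ('r, 'r) module" where
  "ring_as_module R =
    \<lparr>carrier = carrier R, mult = undefined, one = undefined,
     zero = \<zero>\<^bsub>R\<^esub>, add = add R, smult = mult R\<rparr>"

definition direct_sum :: "'i set \<Rightarrow> ('i \<Rightarrow> ('r, 'a, 'y) module_scheme) \<Rightarrow> ('r, 'i \<Rightarrow> 'a) module" where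
  "direct_sum I M =
    \<lparr>carrier = {x \<in> \<Pi>\<^sub>E i\<in>I. carrier (M i). finite {i \<in> I. x i \<noteq> \<zero>\<^bsub>M i\<^esub>}},
     mult = undefined, one = undefined,
     zero = (\<lambda>i\<in>I. \<zero>\<^bsub>M i\<^esub>),
     add = (\<lambda>x y. \<lambda>i\<in>I. x i \<oplus>\<^bsub>M i\<^esub> y i),
     smult = (\<lambda>a x. \<lambda>i\<in>I. a \<odot>\<^bsub>M i\<^esub> x i)\<rparr>"

definition quotient_module :: "('r, 'a, 'y) module_scheme \<Rightarrow> 'a set \<Rightarrow> ('r, 'a set) module" where
  "quotient_module M N =
    \<lparr>carrier = a_rcosets\<^bsub>M\<^esub> N, mult = undefined, one = undefined,
     zero = N,
     add = set_add M,
     smult = (\<lambda>a K. \<Union>x\<in>K. N +>\<^bsub>M\<^esub> (a \<odot>\<^bsub>M\<^esub> x))\<rparr>"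

text \<open>The homology at \<open>B\<close> of \<open>A \<rightarrow> B \<rightarrow> C\<close>, the two maps being \<open>f\<close> and \<open>g\<close>.\<close>

definition homology_at ::
    "('r, 'a, 'x) module_scheme \<Rightarrow> ('a \<Rightarrow> 'b) \<Rightarrow> ('r, 'b, 'y) module_scheme \<Rightarrow> ('b \<Rightarrow> 'c) \<Rightarrow>
     ('r, 'c, 'z) module_scheme \<Rightarrow> ('r, 'b set) module" where
  "homology_at A f B g C =
    quotient_module (B\<lparr>carrier := {x \<in> carrier B. g x = \<zero>\<^bsub>C\<^esub>}\<rparr>) (f ` carrier A)"


section \<open>Poset homology\<close>

definition covers :: "'p set \<Rightarrow> 'p rel \<Rightarrow> 'p \<Rightarrow> 'p \<Rightarrow> bool" where
  "covers P r x y \<longleftrightarrow>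
    x \<in> P \<and> y \<in> P \<and> (x, y) \<in> r \<and> x \<noteq> y \<and>
    \<not> (\<exists>z\<in>P. (x, z) \<in> r \<and> (z, y) \<in> r \<and> z \<noteq> x \<and> z \<noteq> y)"

definition squared_poset :: "'p set \<Rightarrow> 'p rel \<Rightarrow> ('p \<Rightarrow> int) \<Rightarrow> bool" where
  "squared_poset P r rk \<longleftrightarrow>
    finite P \<and> partial_order_on P r \<and>
    (\<forall>x y. covers P r x y \<longrightarrow> rk y = rk x + 1) \<and>
    (\<forall>x y z. covers P r x y \<and> covers P r y z \<longrightarrow>
      (\<exists>!y'. y' \<noteq> y \<and> covers P r x y' \<and> covers P r y' z))"

definition sign_assignment :: "'p set \<Rightarrow> 'p rel \<Rightarrow> ('p \<Rightarrow> 'p \<Rightarrow> bit) \<Rightarrow> bool" where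
  "sign_assignment P r s \<longleftrightarrow>
    (\<forall>x y y' z. covers P r x y \<and> covers P r y z \<and> covers P r x y' \<and> covers P r y' z \<and> y' \<noteq> y \<longrightarrow>
      s x y + s y z = s x y' + s y' z + 1)"

text \<open>Covariant functors from the category of a poset to \<open>R\<close>-modules: \<open>Mor x y\<close> is the image of
  the unique morphism \<open>x \<rightarrow> y\<close>; only its values on the carrier of \<open>Ob x\<close> matter.\<close>

definition functor_to_modules ::
    "('r, 'x) ring_scheme \<Rightarrow> 'p set \<Rightarrow> 'p rel \<Rightarrow> ('p \<Rightarrow> ('r, 'a, 'y) module_scheme) \<Rightarrow>
     ('p \<Rightarrow> 'p \<Rightarrow> 'a \<Rightarrow> 'a) \<Rightarrow> bool" where
  "functor_to_modules R P r Ob Mor \<longleftrightarrow>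
    (\<forall>x\<in>P. module R (Ob x)) \<and>
    (\<forall>x y. (x, y) \<in> r \<longrightarrow> Mor x y \<in> module_hom R (Ob x) (Ob y)) \<and>
    (\<forall>x\<in>P. \<forall>a \<in> carrier (Ob x). Mor x x a = a) \<and>
    (\<forall>x y z. (x, y) \<in> r \<and> (y, z) \<in> r \<longrightarrow>
      (\<forall>a \<in> carrier (Ob x). Mor x z a = Mor y z (Mor x y a)))"

definition sign_scalar :: "('r, 'x) ring_scheme \<Rightarrow> bit \<Rightarrow> 'r" where
  "sign_scalar R t = (if t = 0 then \<one>\<^bsub>R\<^esub> else \<ominus>\<^bsub>R\<^esub> \<one>\<^bsub>R\<^esub>)"

text \<open>Cochain complexes are indexed by \<^typ>\<open>int\<close>; in degrees where there is no element of that rank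
  the direct sum is over the empty set, hence zero.\<close>

definition poset_cochains ::
    "'p set \<Rightarrow> ('p \<Rightarrow> int) \<Rightarrow> ('p \<Rightarrow> ('r, 'a, 'y) module_scheme) \<Rightarrow> int \<Rightarrow> ('r, 'p \<Rightarrow> 'a) module" where
  "poset_cochains P rk Ob n = direct_sum {x \<in> P. rk x = n} Ob"

definition poset_differential ::
    "('r, 'x) ring_scheme \<Rightarrow> 'p set \<Rightarrow> 'p rel \<Rightarrow> ('p \<Rightarrow> int) \<Rightarrow> ('p \<Rightarrow> 'p \<Rightarrow> bit) \<Rightarrow>
     ('p \<Rightarrow> ('r, 'a, 'y) module_scheme) \<Rightarrow> ('p \<Rightarrow> 'p \<Rightarrow> 'a \<Rightarrow> 'a) \<Rightarrow> int \<Rightarrow> ('p \<Rightarrow> 'a) \<Rightarrow> ('p \<Rightarrow> 'a)" where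
  "poset_differential R P r rk s Ob Mor n a =
    (\<lambda>y \<in> {y \<in> P. rk y = n + 1}.
      \<Oplus>\<^bsub>Ob y\<^esub>x \<in> {x \<in> P. rk x = n \<and> covers P r x y}.
        sign_scalar R (s x y) \<odot>\<^bsub>Ob y\<^esub> Mor x y (a x))"

definition poset_homology ::
    "('r, 'x) ring_scheme \<Rightarrow> 'p set \<Rightarrow> 'p rel \<Rightarrow> ('p \<Rightarrow> int) \<Rightarrow> ('p \<Rightarrow> 'p \<Rightarrow> bit) \<Rightarrow>
     ('p \<Rightarrow> ('r, 'a, 'y) module_scheme) \<Rightarrow> ('p \<Rightarrow> 'p \<Rightarrow> 'a \<Rightarrow> 'a) \<Rightarrow> int \<Rightarrow>
     ('r, ('p \<Rightarrow> 'a) set) module" where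
  "poset_homology R P r rk s Ob Mor n =
    homology_at
      (poset_cochains P rk Ob (n - 1)) (poset_differential R P r rk s Ob Mor (n - 1))
      (poset_cochains P rk Ob n) (poset_differential R P r rk s Ob Mor n)
      (poset_cochains P rk Ob (n + 1))"

definition boolean_elems :: "nat \<Rightarrow> nat set set" where
  "boolean_elems m = Pow {1..m}"

definition boolean_le :: "nat \<Rightarrow> nat set rel" where
  "boolean_le m = {(a, b). a \<subseteq> b \<and> b \<subseteq> {1..m}}"

definition boolean_rank :: "nat set \<Rightarrow> int" where
  "boolean_rank b = int (card b)"

lemma covers_boolean_iff:
  "covers (boolean_elems m) (boolean_le m) a b \<longleftrightarrow>
    (\<exists>i. i \<notin> a \<and> b = insert i a \<and> b \<subseteq> {1..m})"
proof
  assume c: "covers (boolean_elems m) (boolean_le m) a b"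
  hence ab: "a \<subseteq> b" "b \<subseteq> {1..m}" "a \<noteq> b"
    by (auto simp: covers_def boolean_le_def)
  then obtain i where i: "i \<in> b" "i \<notin> a" by blast
  have "insert i a = b"
  proof (rule ccontr)
    assume "insert i a \<noteq> b"
    moreover have "insert i a \<in> boolean_elems m" "(a, insert i a) \<in> boolean_le m"
      "(insert i a, b) \<in> boolean_le m" "insert i a \<noteq> a"
      using ab i by (auto simp: boolean_elems_def boolean_le_def)
    ultimately show False using c by (auto simp: covers_def)
  qed
  with i ab show "\<exists>i. i \<notin> a \<and> b = insert i a \<and> b \<subseteq> {1..m}" by blast
next
  assume "\<exists>i. i \<notin> a \<and> b = insert i a \<and> b \<subseteq> {1..m}"
  then show "covers (boolean_elems m) (boolean_le m) a b"
    by (auto simp: covers_def boolean_le_def boolean_elems_def)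
qed

lemma squared_poset_boolean: "squared_poset (boolean_elems m) (boolean_le m) boolean_rank"
  unfolding squared_poset_def
proof (intro conjI allI impI)
  show "finite (boolean_elems m)" by (simp add: boolean_elems_def)
  show "partial_order_on (boolean_elems m) (boolean_le m)"
    by (auto simp: partial_order_on_def preorder_on_def refl_on_def trans_def antisym_def
        boolean_elems_def boolean_le_def)
  show "boolean_rank y = boolean_rank x + 1"
    if "covers (boolean_elems m) (boolean_le m) x y" for x y
  proof -
    from that obtain i where i: "i \<notin> x" "y = insert i x" "y \<subseteq> {1..m}"
      by (auto simp: covers_boolean_iff)
    hence "finite x" using finite_subset[of x "{1..m}"] by auto
    with i show ?thesis by (simp add: boolean_rank_def)
  qed
  show "\<exists>!y'. y' \<noteq> y \<and> covers (boolean_elems m) (boolean_le m) x y' \<and>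
      covers (boolean_elems m) (boolean_le m) y' z"
    if c: "covers (boolean_elems m) (boolean_le m) x y \<and> covers (boolean_elems m) (boolean_le m) y z"
    for x y z
  proof -
    from c obtain i k where ik: "i \<notin> x" "y = insert i x" "k \<notin> y" "z = insert k y" "z \<subseteq> {1..m}"
      unfolding covers_boolean_iff by blast
    show ?thesis
    proof (rule ex1I[of _ "insert k x"])
      show "insert k x \<noteq> y \<and> covers (boolean_elems m) (boolean_le m) x (insert k x) \<and>
          covers (boolean_elems m) (boolean_le m) (insert k x) z"
      proof (intro conjI)
        show "insert k x \<noteq> y" using ik by blast
        show "covers (boolean_elems m) (boolean_le m) x (insert k x)"
          unfolding covers_boolean_iff using ik by (intro exI[of _ k]) blast
        show "covers (boolean_elems m) (boolean_le m) (insert k x) z"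
          unfolding covers_boolean_iff using ik by (intro exI[of _ i]) blast
      qed
      show "y' = insert k x"
        if "y' \<noteq> y \<and> covers (boolean_elems m) (boolean_le m) x y' \<and>
          covers (boolean_elems m) (boolean_le m) y' z" for y'
      proof -
        from that obtain p q where pq: "p \<notin> x" "y' = insert p x" "q \<notin> y'" "z = insert q y'" "y' \<noteq> y"
          unfolding covers_boolean_iff by blast
        have "p \<in> {i, k}" using pq ik by blast
        moreover have "p \<noteq> i" using pq ik by blast
        ultimately show ?thesis using pq by simp
      qed
    qed
  qed
qed

lemma sign_assignment_boolean:
  "sign_assignment (boolean_elems m) (boolean_le m)
    (\<lambda>a b. of_nat (card {j \<in> a. j < the_elem (b - a)}))"
  unfolding sign_assignment_def
proof (intro allI impI, elim conjE)
  fix x y y' z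
  assume c: "covers (boolean_elems m) (boolean_le m) x y" "covers (boolean_elems m) (boolean_le m) y z"
    "covers (boolean_elems m) (boolean_le m) x y'" "covers (boolean_elems m) (boolean_le m) y' z" "y' \<noteq> y"
  from c(1,2) obtain i k where ik: "i \<notin> x" "y = insert i x" "k \<notin> y" "z = insert k y" "z \<subseteq> {1..m}"
    unfolding covers_boolean_iff by blast
  have y': "y' = insert k x"
  proof -
    from c(3,4) obtain p q where pq: "p \<notin> x" "y' = insert p x" "q \<notin> y'" "z = insert q y'"
      unfolding covers_boolean_iff by blast
    have "p \<in> {i, k}" using pq ik by blast
    moreover have "p \<noteq> i" using pq ik c(5) by blast
    ultimately show ?thesis using pq by simp
  qed
  have fin: "finite x" using ik finite_subset[of x "{1..m}"] by auto
  have ne: "i \<noteq> k" "k \<notin> x" using ik by auto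
  have D: "y - x = {i}" "z - y = {k}" "y' - x = {k}" "z - y' = {i}"
    using ik y' ne by auto
  have *: "card {j \<in> insert p x. j < q} = card {j \<in> x. j < q} + (if p < q then 1 else 0)"
    if "p \<notin> x" for p q
  proof -
    have "{j \<in> insert p x. j < q} =
        (if p < q then insert p {j \<in> x. j < q} else {j \<in> x. j < q})" by auto
    thus ?thesis using that fin by simp
  qed
  show "(of_nat (card {j \<in> x. j < the_elem (y - x)}) :: bit) + of_nat (card {j \<in> y. j < the_elem (z - y)})
      = of_nat (card {j \<in> x. j < the_elem (y' - x)}) + of_nat (card {j \<in> y'. j < the_elem (z - y')}) + 1"
    unfolding D the_elem_eq unfolding ik(2) y' *[OF ik(1)] *[OF ne(2)]
    using ne(1) by (cases "i < k") (auto simp: algebra_simps)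
qed


section \<open>Bi-coloured simplicial complexes and horizontal homology\<close>

definition finite_simplicial_complex :: "'v set set \<Rightarrow> bool" where
  "finite_simplicial_complex X \<longleftrightarrow>
    finite X \<and> {} \<notin> X \<and> (\<forall>\<sigma>\<in>X. finite \<sigma>) \<and>
    (\<forall>\<sigma>\<in>X. \<forall>\<tau>. \<tau> \<subseteq> \<sigma> \<and> \<tau> \<noteq> {} \<longrightarrow> \<tau> \<in> X)"

definition vertices :: "'v set set \<Rightarrow> 'v set" where
  "vertices X = \<Union>X"

text \<open>Connectedness by edge paths; the empty complex is not excluded.\<close>

definition connected_complex :: "'v set set \<Rightarrow> bool" where
  "connected_complex X \<longleftrightarrow>
    (\<forall>u \<in> vertices X. \<forall>u' \<in> vertices X. (u, u') \<in> {(a, b). {a, b} \<in> X}\<^sup>*)"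

definition simplex_dim :: "'v set \<Rightarrow> int" where
  "simplex_dim \<sigma> = int (card \<sigma>) - 1"

definition simplices :: "'v set set \<Rightarrow> int \<Rightarrow> 'v set set" where
  "simplices X k = {\<sigma> \<in> X. simplex_dim \<sigma> = k}"

text \<open>In what follows \<open>v\<close> enumerates the vertices as \<open>v 1, \<dots>, v m\<close>, where \<open>m\<close> is their number.\<close>

definition vertex_index :: "'v set set \<Rightarrow> (nat \<Rightarrow> 'v) \<Rightarrow> 'v \<Rightarrow> nat" where
  "vertex_index X v u = inv_into {1..card (vertices X)} v u"

definition bicolourings :: "'v set set \<Rightarrow> ('v \<Rightarrow> int) set" where
  "bicolourings X = vertices X \<rightarrow>\<^sub>E {0, 1}"

definition colour_length :: "'v set set \<Rightarrow> ('v \<Rightarrow> int) \<Rightarrow> int" where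
  "colour_length X \<epsilon> = (\<Sum>u \<in> vertices X. \<epsilon> u)"

definition weight :: "('v \<Rightarrow> int) \<Rightarrow> 'v set \<Rightarrow> int" where
  "weight \<epsilon> \<sigma> = simplex_dim \<sigma> + 1 - (\<Sum>u\<in>\<sigma>. \<epsilon> u)"

definition colour_flip :: "'v set set \<Rightarrow> ('v \<Rightarrow> int) \<Rightarrow> ('v \<Rightarrow> int) \<Rightarrow> bool" where
  "colour_flip X \<epsilon> \<epsilon>' \<longleftrightarrow> (\<exists>u \<in> vertices X. \<epsilon> u = 0 \<and> \<epsilon>' = \<epsilon>(u := 1))"

text \<open>Chains are given by their coefficients: \<open>c\<close> stands for the sum of \<open>c \<sigma>\<close> times \<open>\<sigma>\<close>.\<close>

definition chains :: "('r, 'x) ring_scheme \<Rightarrow> 'v set set \<Rightarrow> int \<Rightarrow> ('r, 'v set \<Rightarrow> 'r) module" where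
  "chains R X k = direct_sum (simplices X k) (\<lambda>_. ring_as_module R)"

text \<open>The coefficient of \<open>\<tau>\<close> in the boundary of \<open>\<sigma>\<close>; there is at most one summand, with sign
  determined by the position of the removed vertex \<open>u\<close> in the ordered simplex \<open>\<sigma>\<close>.\<close>

definition incidence :: "('r, 'x) ring_scheme \<Rightarrow> 'v set set \<Rightarrow> (nat \<Rightarrow> 'v) \<Rightarrow> 'v set \<Rightarrow> 'v set \<Rightarrow> 'r" where
  "incidence R X v \<sigma> \<tau> =
    (\<Oplus>\<^bsub>R\<^esub>u \<in> {u \<in> \<sigma>. \<tau> = \<sigma> - {u}}.
      (\<ominus>\<^bsub>R\<^esub> \<one>\<^bsub>R\<^esub>) [^]\<^bsub>R\<^esub> card {u' \<in> \<sigma>. vertex_index X v u' < vertex_index X v u})"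

definition boundary ::
    "('r, 'x) ring_scheme \<Rightarrow> 'v set set \<Rightarrow> (nat \<Rightarrow> 'v) \<Rightarrow> int \<Rightarrow> ('v set \<Rightarrow> 'r) \<Rightarrow> ('v set \<Rightarrow> 'r)" where
  "boundary R X v k c =
    (\<lambda>\<tau> \<in> simplices X (k - 1). \<Oplus>\<^bsub>R\<^esub>\<sigma> \<in> simplices X k. c \<sigma> \<otimes>\<^bsub>R\<^esub> incidence R X v \<sigma> \<tau>)"

text \<open>The component of \<^const>\<open>boundary\<close> that preserves the weight: only the matrix entries
  between simplices of equal weight are kept.\<close>

definition horizontal_boundary ::
    "('r, 'x) ring_scheme \<Rightarrow> 'v set set \<Rightarrow> (nat \<Rightarrow> 'v) \<Rightarrow> ('v \<Rightarrow> int) \<Rightarrow> int \<Rightarrow>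
     ('v set \<Rightarrow> 'r) \<Rightarrow> ('v set \<Rightarrow> 'r)" where
  "horizontal_boundary R X v \<epsilon> k c =
    (\<lambda>\<tau> \<in> simplices X (k - 1).
      \<Oplus>\<^bsub>R\<^esub>\<sigma> \<in> {\<sigma> \<in> simplices X k. weight \<epsilon> \<sigma> = weight \<epsilon> \<tau>}. c \<sigma> \<otimes>\<^bsub>R\<^esub> incidence R X v \<sigma> \<tau>)"

definition horizontal_homology_deg ::
    "('r, 'x) ring_scheme \<Rightarrow> 'v set set \<Rightarrow> (nat \<Rightarrow> 'v) \<Rightarrow> ('v \<Rightarrow> int) \<Rightarrow> int \<Rightarrow>
     ('r, ('v set \<Rightarrow> 'r) set) module" where
  "horizontal_homology_deg R X v \<epsilon> k =
    homology_at
      (chains R X (k + 1)) (horizontal_boundary R X v \<epsilon> (k + 1))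
      (chains R X k) (horizontal_boundary R X v \<epsilon> k)
      (chains R X (k - 1))"

definition horizontal_homology ::
    "('r, 'x) ring_scheme \<Rightarrow> 'v set set \<Rightarrow> (nat \<Rightarrow> 'v) \<Rightarrow> ('v \<Rightarrow> int) \<Rightarrow>
     ('r, int \<Rightarrow> ('v set \<Rightarrow> 'r) set) module" where
  "horizontal_homology R X v \<epsilon> = direct_sum UNIV (horizontal_homology_deg R X v \<epsilon>)"

definition flip_chain_map ::
    "('r, 'x) ring_scheme \<Rightarrow> 'v set set \<Rightarrow> ('v \<Rightarrow> int) \<Rightarrow> ('v \<Rightarrow> int) \<Rightarrow> int \<Rightarrow>
     ('v set \<Rightarrow> 'r) \<Rightarrow> ('v set \<Rightarrow> 'r)" where
  "flip_chain_map R X \<epsilon> \<epsilon>' k c =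
    (\<lambda>\<sigma> \<in> simplices X k. if weight \<epsilon> \<sigma> = weight \<epsilon>' \<sigma> then c \<sigma> else \<zero>\<^bsub>R\<^esub>)"

text \<open>The map induced on homology sends the class \<open>x k\<close> of a cycle \<open>c\<close> to the class of its image,
  i.e. to its coset modulo the boundaries, which form the zero of the target module.\<close>

definition flip_map ::
    "('r, 'x) ring_scheme \<Rightarrow> 'v set set \<Rightarrow> (nat \<Rightarrow> 'v) \<Rightarrow> ('v \<Rightarrow> int) \<Rightarrow> ('v \<Rightarrow> int) \<Rightarrow>
     (int \<Rightarrow> ('v set \<Rightarrow> 'r) set) \<Rightarrow> (int \<Rightarrow> ('v set \<Rightarrow> 'r) set)" where
  "flip_map R X v \<epsilon> \<epsilon>' x =
    (\<lambda>k. \<Union>c \<in> x k.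
      \<zero>\<^bsub>horizontal_homology_deg R X v \<epsilon>' k\<^esub> +>\<^bsub>chains R X k\<^esub> flip_chain_map R X \<epsilon> \<epsilon>' k c)"


section \<open>Ueberhomology\<close>

definition ueber_cochains ::
    "('r, 'x) ring_scheme \<Rightarrow> 'v set set \<Rightarrow> (nat \<Rightarrow> 'v) \<Rightarrow> int \<Rightarrow>
     ('r, ('v \<Rightarrow> int) \<Rightarrow> int \<Rightarrow> ('v set \<Rightarrow> 'r) set) module" where
  "ueber_cochains R X v j =
    direct_sum {\<epsilon> \<in> bicolourings X. colour_length X \<epsilon> = j} (horizontal_homology R X v)"

definition ueber_differential ::
    "('r, 'x) ring_scheme \<Rightarrow> 'v set set \<Rightarrow> (nat \<Rightarrow> 'v) \<Rightarrow> int \<Rightarrow>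
     (('v \<Rightarrow> int) \<Rightarrow> int \<Rightarrow> ('v set \<Rightarrow> 'r) set) \<Rightarrow> (('v \<Rightarrow> int) \<Rightarrow> int \<Rightarrow> ('v set \<Rightarrow> 'r) set)" where
  "ueber_differential R X v j a =
    (\<lambda>\<epsilon>' \<in> {\<epsilon>' \<in> bicolourings X. colour_length X \<epsilon>' = j + 1}.
      \<Oplus>\<^bsub>horizontal_homology R X v \<epsilon>'\<^esub>\<epsilon> \<in> {\<epsilon> \<in> bicolourings X. colour_length X \<epsilon> = j \<and> colour_flip X \<epsilon> \<epsilon>'}.
        flip_map R X v \<epsilon> \<epsilon>' (a \<epsilon>))"

definition ueberhomology ::
    "('r, 'x) ring_scheme \<Rightarrow> 'v set set \<Rightarrow> (nat \<Rightarrow> 'v) \<Rightarrow> int \<Rightarrow>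
     ('r, (('v \<Rightarrow> int) \<Rightarrow> int \<Rightarrow> ('v set \<Rightarrow> 'r) set) set) module" where
  "ueberhomology R X v j =
    homology_at
      (ueber_cochains R X v (j - 1)) (ueber_differential R X v (j - 1))
      (ueber_cochains R X v j) (ueber_differential R X v j)
      (ueber_cochains R X v (j + 1))"


section \<open>The functor on the Boolean poset\<close>

definition subset_colouring :: "'v set set \<Rightarrow> (nat \<Rightarrow> 'v) \<Rightarrow> nat set \<Rightarrow> ('v \<Rightarrow> int)" where
  "subset_colouring X v b = (\<lambda>u \<in> vertices X. if vertex_index X v u \<in> b then 1 else 0)"

definition H_obj ::
    "('r, 'x) ring_scheme \<Rightarrow> 'v set set \<Rightarrow> (nat \<Rightarrow> 'v) \<Rightarrow> nat set \<Rightarrow>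
     ('r, int \<Rightarrow> ('v set \<Rightarrow> 'r) set) module" where
  "H_obj R X v b = horizontal_homology R X v (subset_colouring X v b)"

text \<open>The composite of the maps on covering relations along the saturated chain that starts at
  \<open>b\<close> and adds the elements of a list one by one.\<close>

fun H_chain ::
    "('r, 'x) ring_scheme \<Rightarrow> 'v set set \<Rightarrow> (nat \<Rightarrow> 'v) \<Rightarrow> nat list \<Rightarrow> nat set \<Rightarrow>
     (int \<Rightarrow> ('v set \<Rightarrow> 'r) set) \<Rightarrow> (int \<Rightarrow> ('v set \<Rightarrow> 'r) set)" where
  "H_chain R X v [] b = id"
| "H_chain R X v (i # is) b =
    H_chain R X v is (insert i b) \<circ>
    flip_map R X v (subset_colouring X v b) (subset_colouring X v (insert i b))"

text \<open>The extension to all morphisms by composition is defined along the chain adding the missing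
  elements in increasing order; that any other saturated chain has the same composite is part of
  the functoriality of \<open>H_mor\<close>.\<close>

definition H_mor ::
    "('r, 'x) ring_scheme \<Rightarrow> 'v set set \<Rightarrow> (nat \<Rightarrow> 'v) \<Rightarrow> nat set \<Rightarrow> nat set \<Rightarrow>
     (int \<Rightarrow> ('v set \<Rightarrow> 'r) set) \<Rightarrow> (int \<Rightarrow> ('v set \<Rightarrow> 'r) set)" where
  "H_mor R X v b b' = H_chain R X v (sorted_list_of_set (b' - b)) b"

lemma H_mor_covers:
  assumes "covers (boolean_elems m) (boolean_le m) b b'"
  shows "H_mor R X v b b' = flip_map R X v (subset_colouring X v b) (subset_colouring X v b')"
proof -
  from assms obtain i where "i \<notin> b" "b' = insert i b"
    by (auto simp: covers_boolean_iff)
  moreover from this have "b' - b = {i}" by auto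
  ultimately show ?thesis by (simp add: H_mor_def)
qed

end

theory Submission
  imports Defs
begin

text \<open>Taking supports of bi-colourings (\<open>\<epsilon> \<mapsto> {i. \<epsilon> (v i) = 1}\<close>) is a bijection onto the Boolean
  poset that turns the length into the rank and the flips of one vertex into the covering relations.
  Over \<open>\<epsilon>\<close> both cochain complexes have the same module of coefficients, the horizontal homology of
  \<open>\<epsilon>\<close>, and on a covering relation the functor is the flip map. The signs of the poset
  differential are \<open>\<plusminus>1\<close>, hence \<open>1\<close> in characteristic two. So reindexing along the bijection is an
  isomorphism of complexes (\<open>reindex_iso\<close>, \<open>reindex_differential\<close>) and induces one of homology
  (\<open>homology_isomorphic\<close>).

  The remaining work is to see that the objects in play exist. Horizontal homology is a module because
  the horizontal boundary squares to zero: if \<open>u\<close> and \<open>w\<close> can be removed from a simplex horizontally,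
  they can be removed in either order, and the two contributions cancel since \<open>1 + 1 = 0\<close>
  (\<open>incidence_square_zero\<close>). Poset homology is a module for the same reason, now by the squares of the
  poset and the sign condition on them (\<open>entry_square_zero\<close>).

  Functoriality asks that the composite of flips along a saturated chain does not depend on the chain.
  The defining formula of the flip map makes sense for any two colourings \<open>\<epsilon> \<le> \<epsilon>'\<close>: it keeps the
  simplices on which the two agree. This is a chain map (\<open>flip_commutes\<close>), and it is transitive
  (\<open>flip_map_trans\<close>), because a simplex survives all flips of a chain iff the first and the last
  colouring agree on it. So every composite equals the flip map between the end points
  (\<open>H_mor_eq_flip\<close>).\<close>

section \<open>Homomorphisms of modules\<close>

lemma module_homD:
  assumes "f \<in> module_hom R M N"
  shows "\<And>x. x \<in> carrier M \<Longrightarrow> f x \<in> carrier N"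
    and "\<And>x y. x \<in> carrier M \<Longrightarrow> y \<in> carrier M \<Longrightarrow> f (x \<oplus>\<^bsub>M\<^esub> y) = f x \<oplus>\<^bsub>N\<^esub> f y"
    and "\<And>a x. a \<in> carrier R \<Longrightarrow> x \<in> carrier M \<Longrightarrow> f (a \<odot>\<^bsub>M\<^esub> x) = a \<odot>\<^bsub>N\<^esub> f x"
  using assms by (auto simp: module_hom_def)

lemma module_homI:
  assumes "\<And>x. x \<in> carrier M \<Longrightarrow> f x \<in> carrier N"
    and "\<And>x y. x \<in> carrier M \<Longrightarrow> y \<in> carrier M \<Longrightarrow> f (x \<oplus>\<^bsub>M\<^esub> y) = f x \<oplus>\<^bsub>N\<^esub> f y"
    and "\<And>a x. a \<in> carrier R \<Longrightarrow> x \<in> carrier M \<Longrightarrow> f (a \<odot>\<^bsub>M\<^esub> x) = a \<odot>\<^bsub>N\<^esub> f x"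
  shows "f \<in> module_hom R M N"
  using assms by (auto simp: module_hom_def)

lemma module_hom_zero:
  assumes "module R M" "module R N" "f \<in> module_hom R M N"
  shows "f \<zero>\<^bsub>M\<^esub> = \<zero>\<^bsub>N\<^esub>"
proof -
  interpret M: module R M by fact
  interpret N: module R N by fact
  have "f \<zero>\<^bsub>M\<^esub> = f (\<zero>\<^bsub>R\<^esub> \<odot>\<^bsub>M\<^esub> \<zero>\<^bsub>M\<^esub>)" by simp
  also have "\<dots> = \<zero>\<^bsub>R\<^esub> \<odot>\<^bsub>N\<^esub> f \<zero>\<^bsub>M\<^esub>" by (rule module_homD(3)[OF assms(3)]) auto
  also have "\<dots> = \<zero>\<^bsub>N\<^esub>" using module_homD(1)[OF assms(3)] by simp
  finally show ?thesis .
qed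

lemma module_hom_uminus:
  assumes "module R M" "module R N" "f \<in> module_hom R M N" "x \<in> carrier M"
  shows "f (\<ominus>\<^bsub>M\<^esub> x) = \<ominus>\<^bsub>N\<^esub> f x"
proof -
  interpret M: module R M by fact
  interpret N: module R N by fact
  have "f (\<ominus>\<^bsub>M\<^esub> x) \<oplus>\<^bsub>N\<^esub> f x = f (\<ominus>\<^bsub>M\<^esub> x \<oplus>\<^bsub>M\<^esub> x)"
    using assms(4) by (simp add: module_homD(2)[OF assms(3)])
  also have "\<dots> = \<zero>\<^bsub>N\<^esub>"
    using assms(4) by (simp add: M.l_neg module_hom_zero[OF assms(1-3)])
  finally show ?thesis
    using N.minus_equality module_homD(1)[OF assms(3)] assms(4) by (metis M.a_inv_closed)
qed

lemma module_hom_cong: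
  assumes "module R M" "f \<in> module_hom R M N" "\<And>x. x \<in> carrier M \<Longrightarrow> g x = f x"
  shows "g \<in> module_hom R M N"
proof -
  interpret M: module R M by fact
  show ?thesis
    by (rule module_homI) (simp_all add: assms(3) module_homD[OF assms(2)])
qed

lemma module_hom_finsum:
  assumes "module R M" "module R N" "f \<in> module_hom R M N" "h \<in> S \<rightarrow> carrier M"
  shows "f (\<Oplus>\<^bsub>M\<^esub>i\<in>S. h i) = (\<Oplus>\<^bsub>N\<^esub>i\<in>S. f (h i))"
proof -
  interpret M: module R M by fact
  interpret N: module R N by fact
  show ?thesis
    using assms(4)
  proof (induct S rule: infinite_finite_induct)
    case (insert x S)
    moreover from insert have "(\<lambda>i. f (h i)) \<in> S \<rightarrow> carrier N" "f (h x) \<in> carrier N"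
      using module_homD(1)[OF assms(3)] by auto
    ultimately show ?case
      by (simp add: module_homD(2)[OF assms(3)] Pi_def)
  qed (simp_all add: module_hom_zero[OF assms(1-3)])
qed

lemma module_hom_zero_map:
  assumes "module R M" "module R N"
  shows "(\<lambda>_. \<zero>\<^bsub>N\<^esub>) \<in> module_hom R M N"
proof -
  interpret N: module R N by fact
  show ?thesis by (rule module_homI) auto
qed

lemma module_hom_smult:
  assumes "module R M" "module R N" "f \<in> module_hom R M N" "a \<in> carrier R"
  shows "(\<lambda>x. a \<odot>\<^bsub>N\<^esub> f x) \<in> module_hom R M N"
proof -
  interpret N: module R N by fact
  show ?thesis
  proof (rule module_homI)
    fix b x assume b: "b \<in> carrier R" "x \<in> carrier M"
    have "a \<odot>\<^bsub>N\<^esub> (b \<odot>\<^bsub>N\<^esub> f x) = b \<odot>\<^bsub>N\<^esub> (a \<odot>\<^bsub>N\<^esub> f x)"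
      using b assms(4) module_homD(1)[OF assms(3)] N.R.m_comm by (simp flip: N.smult_assoc1)
    then show "a \<odot>\<^bsub>N\<^esub> f (b \<odot>\<^bsub>M\<^esub> x) = b \<odot>\<^bsub>N\<^esub> (a \<odot>\<^bsub>N\<^esub> f x)"
      using b by (simp add: module_homD(3)[OF assms(3)])
  qed (use assms(4) in \<open>auto simp: module_homD[OF assms(3)] N.smult_r_distr\<close>)
qed

lemma kernel_submodule:
  assumes "module R M" "module R N" "f \<in> module_hom R M N"
  shows "submodule {x \<in> carrier M. f x = \<zero>\<^bsub>N\<^esub>} R M"
proof -
  interpret M: module R M by fact
  interpret N: module R N by fact
  show ?thesis
    by (rule M.submoduleI)
      (auto simp: module_homD[OF assms(3)] module_hom_zero[OF assms] module_hom_uminus[OF assms])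
qed

lemma image_submodule:
  assumes "module R M" "module R N" "f \<in> module_hom R M N"
  shows "submodule (f ` carrier M) R N"
proof -
  interpret M: module R M by fact
  interpret N: module R N by fact
  show ?thesis
  proof (rule N.submoduleI)
    show "\<zero>\<^bsub>N\<^esub> \<in> f ` carrier M"
      by (metis M.zero_closed image_eqI module_hom_zero[OF assms])
    show "\<And>a. a \<in> f ` carrier M \<Longrightarrow> \<ominus>\<^bsub>N\<^esub> a \<in> f ` carrier M"
      using module_hom_uminus[OF assms] by (metis (no_types, lifting) M.a_inv_closed imageE imageI)
    show "\<And>a b. a \<in> f ` carrier M \<Longrightarrow> b \<in> f ` carrier M \<Longrightarrow> a \<oplus>\<^bsub>N\<^esub> b \<in> f ` carrier M"
      using module_homD(2)[OF assms(3)] by (metis (no_types, lifting) M.a_closed imageE imageI)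
    show "\<And>a x. a \<in> carrier R \<Longrightarrow> x \<in> f ` carrier M \<Longrightarrow> a \<odot>\<^bsub>N\<^esub> x \<in> f ` carrier M"
      using module_homD(3)[OF assms(3)] by (metis (no_types, lifting) M.smult_closed imageE imageI)
  qed (use module_homD(1)[OF assms(3)] in auto)
qed

lemma submodule_of_submodule:
  assumes "module R M" "submodule N R M" "submodule Z R M" "N \<subseteq> Z"
  shows "submodule N R (M\<lparr>carrier := Z\<rparr>)"
proof (rule module.module_incl_imp_submodule)
  show "module R (M\<lparr>carrier := Z\<rparr>)"
    by (rule submodule.submodule_is_module[OF assms(3,1)])
  show "module R (M\<lparr>carrier := Z, carrier := N\<rparr>)"
    using submodule.submodule_is_module[OF assms(2,1)] by simp
qed (use assms in simp)


section \<open>Quotients and homology\<close>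

lemma submodule_abelian_subgroup:
  assumes "module R M" "submodule N R M"
  shows "abelian_subgroup N M"
  using assms by (intro abelian_subgroupI3 additive_subgroupI)
    (auto simp: module_def submodule_def)

context
  fixes R M N
  assumes M: "module R M" and N: "submodule N R M"
begin

interpretation module R M by (rule M)
interpretation abelian_subgroup N M by (rule submodule_abelian_subgroup[OF M N])

lemma coset_eq_iff:
  assumes "x \<in> carrier M" "y \<in> carrier M"
  shows "N +>\<^bsub>M\<^esub> x = N +>\<^bsub>M\<^esub> y \<longleftrightarrow> x \<ominus>\<^bsub>M\<^esub> y \<in> N"
  using a_repr_independence'[of x y] a_repr_independenceD[of x y] a_rcos_module[of y x] assms
  by (auto simp: a_minus_def)

lemma coset_member:
  assumes "x \<in> carrier M" "c \<in> N +>\<^bsub>M\<^esub> x"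
  shows "c \<in> carrier M" "N +>\<^bsub>M\<^esub> c = N +>\<^bsub>M\<^esub> x"
  using assms a_elemrcos_carrier a_repr_independence' by auto

lemma coset_zero: "N +>\<^bsub>M\<^esub> \<zero>\<^bsub>M\<^esub> = N"
  by (rule a_rcos_const) (rule additive_subgroup.zero_closed[OF is_additive_subgroup])

text \<open>The scalar multiple of a coset is defined through all representatives at once; they agree
  because \<open>N\<close> is closed under scalars.\<close>

lemma quotient_smult_coset:
  assumes "a \<in> carrier R" "x \<in> carrier M"
  shows "a \<odot>\<^bsub>quotient_module M N\<^esub> (N +>\<^bsub>M\<^esub> x) = N +>\<^bsub>M\<^esub> (a \<odot>\<^bsub>M\<^esub> x)"
proof -
  have "N +>\<^bsub>M\<^esub> (a \<odot>\<^bsub>M\<^esub> c) = N +>\<^bsub>M\<^esub> (a \<odot>\<^bsub>M\<^esub> x)" if c: "c \<in> N +>\<^bsub>M\<^esub> x" for c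
  proof -
    have cM: "c \<in> carrier M" and "c \<ominus>\<^bsub>M\<^esub> x \<in> N"
      using coset_member[OF assms(2) c] coset_eq_iff[of c x] assms by auto
    then have "a \<odot>\<^bsub>M\<^esub> (c \<ominus>\<^bsub>M\<^esub> x) \<in> N"
      by (intro submodule.smult_closed[OF N] assms)
    moreover have "a \<odot>\<^bsub>M\<^esub> (c \<ominus>\<^bsub>M\<^esub> x) = a \<odot>\<^bsub>M\<^esub> c \<ominus>\<^bsub>M\<^esub> a \<odot>\<^bsub>M\<^esub> x"
      using cM assms by (simp add: a_minus_def smult_r_distr smult_r_minus)
    ultimately show ?thesis using cM assms by (simp add: coset_eq_iff)
  qed
  moreover have "x \<in> N +>\<^bsub>M\<^esub> x" using assms(2) a_rcos_self by blast
  ultimately have "(\<Union>c\<in>N +>\<^bsub>M\<^esub> x. N +>\<^bsub>M\<^esub> (a \<odot>\<^bsub>M\<^esub> c)) = N +>\<^bsub>M\<^esub> (a \<odot>\<^bsub>M\<^esub> x)"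
    by (intro UN_constant_eq ballI)
  then show ?thesis by (simp add: quotient_module_def)
qed

lemma quotient_carrier: "carrier (quotient_module M N) = (\<lambda>x. N +>\<^bsub>M\<^esub> x) ` carrier M"
  by (auto simp: quotient_module_def A_RCOSETS_def')

lemma quotient_zero: "\<zero>\<^bsub>quotient_module M N\<^esub> = N"
  by (simp add: quotient_module_def)

lemma quotient_add_coset:
  assumes "x \<in> carrier M" "y \<in> carrier M"
  shows "(N +>\<^bsub>M\<^esub> x) \<oplus>\<^bsub>quotient_module M N\<^esub> (N +>\<^bsub>M\<^esub> y) = N +>\<^bsub>M\<^esub> (x \<oplus>\<^bsub>M\<^esub> y)"
  using a_rcos_sum[OF assms] by (simp add: quotient_module_def)

lemma quotient_module_module: "module R (quotient_module M N)"
proof (rule moduleI)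
  show "cring R" by (rule R.cring_axioms)
  show "abelian_group (quotient_module M N)"
  proof (rule abelian_groupI; unfold quotient_carrier quotient_zero; (elim imageE)?; hypsubst?)
    show "N \<in> (\<lambda>x. N +>\<^bsub>M\<^esub> x) ` carrier M"
      using coset_zero by (metis M.zero_closed imageI)
    fix x assume x: "x \<in> carrier M"
    show "N \<oplus>\<^bsub>quotient_module M N\<^esub> (N +>\<^bsub>M\<^esub> x) = N +>\<^bsub>M\<^esub> x"
      using quotient_add_coset[of "\<zero>\<^bsub>M\<^esub>" x] x by (simp add: coset_zero)
    show "\<exists>K \<in> (\<lambda>x. N +>\<^bsub>M\<^esub> x) ` carrier M. K \<oplus>\<^bsub>quotient_module M N\<^esub> (N +>\<^bsub>M\<^esub> x) = N"
      using x by (intro bexI[of _ "N +>\<^bsub>M\<^esub> (\<ominus>\<^bsub>M\<^esub> x)"])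
        (auto simp: quotient_add_coset M.l_neg coset_zero)
  qed (auto simp: quotient_add_coset M.a_ac)
qed (auto simp: quotient_carrier quotient_smult_coset quotient_add_coset smult_l_distr
    smult_r_distr smult_assoc1)

end

text \<open>Only the three consecutive modules that \<^const>\<open>homology_at\<close> refers to are considered, so that
  no grading has to be carried along.\<close>

definition complex_at ::
    "('r, 'x) ring_scheme \<Rightarrow> ('r, 'a, 'u) module_scheme \<Rightarrow> ('a \<Rightarrow> 'b) \<Rightarrow> ('r, 'b, 'y) module_scheme \<Rightarrow>
     ('b \<Rightarrow> 'c) \<Rightarrow> ('r, 'c, 'z) module_scheme \<Rightarrow> bool" where
  "complex_at R A f B g C \<longleftrightarrow>
    module R A \<and> module R B \<and> module R C \<and> f \<in> module_hom R A B \<and> g \<in> module_hom R B C \<and>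
    (\<forall>x \<in> carrier A. g (f x) = \<zero>\<^bsub>C\<^esub>)"

abbreviation cycles ::
    "('r, 'b, 'y) module_scheme \<Rightarrow> ('b \<Rightarrow> 'c) \<Rightarrow> ('r, 'c, 'z) module_scheme \<Rightarrow> 'b set" where
  "cycles B g C \<equiv> {x \<in> carrier B. g x = \<zero>\<^bsub>C\<^esub>}"

abbreviation boundaries :: "('r, 'a, 'u) module_scheme \<Rightarrow> ('a \<Rightarrow> 'b) \<Rightarrow> 'b set" where
  "boundaries A f \<equiv> f ` carrier A"

lemma a_r_coset_carrier_update [simp]: "a_r_coset (M\<lparr>carrier := Z\<rparr>) = a_r_coset M"
  by (intro ext) (simp add: a_r_coset_def')

context
  fixes R A f B g C
  assumes complex: "complex_at R A f B g C"
begin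

lemma complex_atD:
  shows "module R A" "module R B" "module R C" "f \<in> module_hom R A B" "g \<in> module_hom R B C"
    "\<And>x. x \<in> carrier A \<Longrightarrow> g (f x) = \<zero>\<^bsub>C\<^esub>"
  using complex by (auto simp: complex_at_def)

lemma cycles_submodule: "submodule (cycles B g C) R B"
  by (rule kernel_submodule) (rule complex_atD)+

lemma boundaries_submodule: "submodule (boundaries A f) R B"
  by (rule image_submodule) (rule complex_atD)+

lemma cycles_module: "module R (B\<lparr>carrier := cycles B g C\<rparr>)"
  by (rule submodule.submodule_is_module[OF cycles_submodule complex_atD(2)])

lemma boundaries_submodule_cycles: "submodule (boundaries A f) R (B\<lparr>carrier := cycles B g C\<rparr>)"
  by (rule submodule_of_submodule[OF complex_atD(2) boundaries_submodule cycles_submodule])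
    (auto simp: complex_atD(6) module_homD(1)[OF complex_atD(4)])

lemma homology_module: "module R (homology_at A f B g C)"
  unfolding homology_at_def
  by (rule quotient_module_module[OF cycles_module boundaries_submodule_cycles])

lemma homology_carrier:
  "carrier (homology_at A f B g C) = (\<lambda>z. boundaries A f +>\<^bsub>B\<^esub> z) ` cycles B g C"
  using quotient_carrier[OF cycles_module boundaries_submodule_cycles] by (simp add: homology_at_def)

lemma homology_add:
  assumes "x \<in> cycles B g C" "y \<in> cycles B g C"
  shows "(boundaries A f +>\<^bsub>B\<^esub> x) \<oplus>\<^bsub>homology_at A f B g C\<^esub> (boundaries A f +>\<^bsub>B\<^esub> y)
    = boundaries A f +>\<^bsub>B\<^esub> (x \<oplus>\<^bsub>B\<^esub> y)"
  using quotient_add_coset[OF cycles_module boundaries_submodule_cycles, of x y] assms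
  by (simp add: homology_at_def)

lemma homology_smult:
  assumes "a \<in> carrier R" "x \<in> cycles B g C"
  shows "a \<odot>\<^bsub>homology_at A f B g C\<^esub> (boundaries A f +>\<^bsub>B\<^esub> x) = boundaries A f +>\<^bsub>B\<^esub> (a \<odot>\<^bsub>B\<^esub> x)"
  using quotient_smult_coset[OF cycles_module boundaries_submodule_cycles, of a x] assms
  by (simp add: homology_at_def)

end

text \<open>The formula by which \<^const>\<open>flip_map\<close> acts in each degree, for an arbitrary map \<open>\<phi>\<close>. It takes
  the union over all representatives of \<open>K\<close>, which is a single coset as soon as \<open>\<phi>\<close> respects the
  submodules.\<close>

definition induced_map :: "'b set \<Rightarrow> ('r, 'b, 'y) module_scheme \<Rightarrow> ('a \<Rightarrow> 'b) \<Rightarrow> 'a set \<Rightarrow> 'b set" where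
  "induced_map N' M' \<phi> K = (\<Union>c\<in>K. N' +>\<^bsub>M'\<^esub> \<phi> c)"

lemma induced_map_coset:
  assumes "module R M" "submodule N R M" "module R M'" "submodule N' R M'"
    and \<phi>: "\<phi> \<in> module_hom R M M'" "\<phi> ` N \<subseteq> N'" and z: "z \<in> carrier M"
  shows "induced_map N' M' \<phi> (N +>\<^bsub>M\<^esub> z) = N' +>\<^bsub>M'\<^esub> \<phi> z"
proof -
  interpret M: module R M by fact
  interpret M': module R M' by fact
  have "N' +>\<^bsub>M'\<^esub> \<phi> c = N' +>\<^bsub>M'\<^esub> \<phi> z" if c: "c \<in> N +>\<^bsub>M\<^esub> z" for c
  proof -
    note cM = coset_member[OF assms(1,2) z c]
    have "c \<ominus>\<^bsub>M\<^esub> z \<in> N" using cM coset_eq_iff[OF assms(1,2)] z by blast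
    then have "\<phi> (c \<ominus>\<^bsub>M\<^esub> z) \<in> N'" using \<phi>(2) by blast
    moreover have "\<phi> (c \<ominus>\<^bsub>M\<^esub> z) = \<phi> c \<ominus>\<^bsub>M'\<^esub> \<phi> z"
      using cM z module_homD(2)[OF \<phi>(1)] module_hom_uminus[OF assms(1,3) \<phi>(1)]
      by (simp add: a_minus_def)
    ultimately show ?thesis
      using coset_eq_iff[OF assms(3,4)] module_homD(1)[OF \<phi>(1)] cM z by simp
  qed
  moreover have "z \<in> N +>\<^bsub>M\<^esub> z"
    using abelian_subgroup.a_rcos_self[OF submodule_abelian_subgroup[OF assms(1,2)]] z by blast
  ultimately show ?thesis unfolding induced_map_def by (intro UN_constant_eq ballI)
qed

lemma induced_map_homology_hom:
  assumes c: "complex_at R A f B g C" and c': "complex_at R A' f' B' g' C'"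
    and \<phi>: "\<phi> \<in> module_hom R B B'" "\<phi> ` boundaries A f \<subseteq> boundaries A' f'"
      "\<phi> ` cycles B g C \<subseteq> cycles B' g' C'"
  shows "induced_map (boundaries A' f') B' \<phi>
    \<in> module_hom R (homology_at A f B g C) (homology_at A' f' B' g' C')"
proof -
  interpret B: module R B by (rule complex_atD(2)[OF c])
  note ind = induced_map_coset[OF complex_atD(2)[OF c] boundaries_submodule[OF c]
      complex_atD(2)[OF c'] boundaries_submodule[OF c'] \<phi>(1,2)]
  note Z = submodule.smult_closed[OF cycles_submodule[OF c]]
    module.submoduleE(5)[OF complex_atD(2)[OF c] cycles_submodule[OF c]]
  note rep = homology_carrier[OF c]
  have *: "\<phi> z \<in> cycles B' g' C'" if "z \<in> cycles B g C" for z using that \<phi>(3) by blast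
  show ?thesis
  proof (rule module_homI; unfold rep; elim imageE; hypsubst)
    fix z assume z: "z \<in> cycles B g C"
    then show "induced_map (boundaries A' f') B' \<phi> (boundaries A f +>\<^bsub>B\<^esub> z)
        \<in> carrier (homology_at A' f' B' g' C')"
      using * ind homology_carrier[OF c'] by auto
    fix a assume a: "a \<in> carrier R"
    show "induced_map (boundaries A' f') B' \<phi> (a \<odot>\<^bsub>homology_at A f B g C\<^esub> (boundaries A f +>\<^bsub>B\<^esub> z)) =
      a \<odot>\<^bsub>homology_at A' f' B' g' C'\<^esub> induced_map (boundaries A' f') B' \<phi> (boundaries A f +>\<^bsub>B\<^esub> z)"
      using a z *[OF z] by (simp add: homology_smult[OF c] homology_smult[OF c'] ind
          module_homD(3)[OF \<phi>(1)])
  next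
    fix z w assume z: "z \<in> cycles B g C" "w \<in> cycles B g C"
    show "induced_map (boundaries A' f') B' \<phi> ((boundaries A f +>\<^bsub>B\<^esub> z)
        \<oplus>\<^bsub>homology_at A f B g C\<^esub> (boundaries A f +>\<^bsub>B\<^esub> w)) =
      induced_map (boundaries A' f') B' \<phi> (boundaries A f +>\<^bsub>B\<^esub> z)
        \<oplus>\<^bsub>homology_at A' f' B' g' C'\<^esub> induced_map (boundaries A' f') B' \<phi> (boundaries A f +>\<^bsub>B\<^esub> w)"
      using z *[OF z(1)] *[OF z(2)] by (simp add: homology_add[OF c] homology_add[OF c'] ind
          module_homD(2)[OF \<phi>(1)])
  qed
qed

text \<open>The maps of the second sequence are conjugates of those of the first, so it is a complex as well.
  The induced map sends a coset to its image under \<open>\<beta>\<close>, so it is injective because \<open>\<beta>\<close> is;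
  it is onto because \<open>\<alpha>\<close> being onto identifies the boundaries, and \<open>\<gamma>\<close> being injective the cycles.\<close>

lemma homology_isomorphic:
  assumes c: "complex_at R A f B g C" and "module R A'" "module R B'" "module R C'"
    and \<alpha>: "\<alpha> \<in> module_hom R A A'" "bij_betw \<alpha> (carrier A) (carrier A')"
    and \<beta>: "\<beta> \<in> module_hom R B B'" "bij_betw \<beta> (carrier B) (carrier B')"
    and \<gamma>: "\<gamma> \<in> module_hom R C C'" "bij_betw \<gamma> (carrier C) (carrier C')"
    and f': "\<And>x. x \<in> carrier A \<Longrightarrow> f' (\<alpha> x) = \<beta> (f x)"
    and g': "\<And>x. x \<in> carrier B \<Longrightarrow> g' (\<beta> x) = \<gamma> (g x)"
  shows "module_isomorphic R (homology_at A f B g C) (homology_at A' f' B' g' C')"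
proof -
  interpret A: module R A by (rule complex_atD(1)[OF c])
  interpret B: module R B by (rule complex_atD(2)[OF c])
  interpret C: module R C by (rule complex_atD(3)[OF c])
  note f = complex_atD(4)[OF c] and g = complex_atD(5)[OF c]
  \<comment> \<open>A map conjugate to a homomorphism is one; needed for both maps of the second sequence.\<close>
  have transport: "k' \<in> module_hom R M' N'"
    if "module R M" "\<mu> \<in> module_hom R M M'" "bij_betw \<mu> (carrier M) (carrier M')" "\<nu> \<in> module_hom R N N'"
      "k \<in> module_hom R M N" and k': "\<And>x. x \<in> carrier M \<Longrightarrow> k' (\<mu> x) = \<nu> (k x)"
    for k k' and \<mu> :: "'p \<Rightarrow> 'q" and \<nu> :: "'s \<Rightarrow> 't" and M :: "('a, 'p, 'mm) module_scheme"
      and M' :: "('a, 'q, 'mn) module_scheme" and N :: "('a, 's, 'nn) module_scheme"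
      and N' :: "('a, 't, 'no) module_scheme"
  proof -
    interpret M: module R M by fact
    have M': "carrier M' = \<mu> ` carrier M" using that(3) by (simp add: bij_betw_imp_surj_on)
    show ?thesis
    proof (rule module_homI; unfold M'; elim imageE; hypsubst)
      show "k' (\<mu> x) \<in> carrier N'" if "x \<in> carrier M" for x
        using that module_homD(1)[OF \<open>\<nu> \<in> _\<close>] module_homD(1)[OF \<open>k \<in> _\<close>] k' by simp
      show "k' (\<mu> x \<oplus>\<^bsub>M'\<^esub> \<mu> y) = k' (\<mu> x) \<oplus>\<^bsub>N'\<^esub> k' (\<mu> y)" if "x \<in> carrier M" "y \<in> carrier M" for x y
        using that k'[of "x \<oplus>\<^bsub>M\<^esub> y"]
        by (simp add: k' module_homD[OF \<open>\<nu> \<in> _\<close>] module_homD[OF \<open>k \<in> _\<close>] module_homD(2)[OF \<open>\<mu> \<in> _\<close>])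
      show "k' (a \<odot>\<^bsub>M'\<^esub> \<mu> x) = a \<odot>\<^bsub>N'\<^esub> k' (\<mu> x)" if "a \<in> carrier R" "x \<in> carrier M" for a x
        using that k'[of "a \<odot>\<^bsub>M\<^esub> x"]
        by (simp add: k' module_homD[OF \<open>\<nu> \<in> _\<close>] module_homD[OF \<open>k \<in> _\<close>] module_homD(3)[OF \<open>\<mu> \<in> _\<close>])
    qed
  qed
  have A': "carrier A' = \<alpha> ` carrier A" and B': "carrier B' = \<beta> ` carrier B"
    using \<alpha>(2) \<beta>(2) by (simp_all add: bij_betw_imp_surj_on)
  have c': "complex_at R A' f' B' g' C'"
    unfolding complex_at_def
  proof (intro conjI ballI)
    show "f' \<in> module_hom R A' B'"
      by (rule transport[OF A.module_axioms \<alpha> \<beta>(1) f f'])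
    show "g' \<in> module_hom R B' C'"
      by (rule transport[OF B.module_axioms \<beta> \<gamma>(1) g g'])
    show "g' (f' x) = \<zero>\<^bsub>C'\<^esub>" if x: "x \<in> carrier A'" for x
      using x module_homD(1)[OF f] complex_atD(6)[OF c]
        module_hom_zero[OF C.module_axioms assms(4) \<gamma>(1)]
      by (auto simp: A' f' g')
  qed fact+
  have im: "boundaries A' f' = \<beta> ` boundaries A f"
    by (simp add: A' image_image f')
  have "g x = \<zero>\<^bsub>C\<^esub> \<longleftrightarrow> \<gamma> (g x) = \<zero>\<^bsub>C'\<^esub>" if "x \<in> carrier B" for x
    using that \<gamma>(2) module_hom_zero[OF C.module_axioms assms(4) \<gamma>(1)] module_homD(1)[OF g]
    by (metis C.zero_closed bij_betw_inv_into_left)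
  then have ker: "cycles B' g' C' = \<beta> ` cycles B g C"
    by (auto simp: B' g')
  let ?I = "induced_map (boundaries A' f') B' \<beta>"
  have hom: "?I \<in> module_hom R (homology_at A f B g C) (homology_at A' f' B' g' C')"
    by (rule induced_map_homology_hom[OF c c' \<beta>(1)]) (auto simp: im ker)
  have coset: "?I (boundaries A f +>\<^bsub>B\<^esub> z) = \<beta> ` (boundaries A f +>\<^bsub>B\<^esub> z)" if z: "z \<in> cycles B g C" for z
  proof -
    have "?I (boundaries A f +>\<^bsub>B\<^esub> z) = boundaries A' f' +>\<^bsub>B'\<^esub> \<beta> z"
      using z by (intro induced_map_coset[OF B.module_axioms boundaries_submodule[OF c] assms(3)
          boundaries_submodule[OF c'] \<beta>(1)]) (auto simp: im)
    also have "\<dots> = \<beta> ` (boundaries A f +>\<^bsub>B\<^esub> z)"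
      using z by (auto simp: im a_r_coset_def' module_homD(2)[OF \<beta>(1)] module_homD(1)[OF f]
          image_image image_UN)
    finally show ?thesis .
  qed
  have "inj_on ?I (carrier (homology_at A f B g C))"
  proof (rule inj_onI)
    fix K L assume K: "K \<in> carrier (homology_at A f B g C)" "L \<in> carrier (homology_at A f B g C)"
      and eq: "?I K = ?I L"
    then have "\<beta> ` K = \<beta> ` L" using coset by (auto simp: homology_carrier[OF c])
    moreover have "K \<subseteq> carrier B" "L \<subseteq> carrier B"
      using K coset_member(1)[OF B.module_axioms boundaries_submodule[OF c]]
      by (auto simp: homology_carrier[OF c])
    ultimately show "K = L"
      using inj_on_image_eq_iff[OF bij_betw_imp_inj_on[OF \<beta>(2)]] by blast
  qed
  moreover have "?I ` carrier (homology_at A f B g C) = carrier (homology_at A' f' B' g' C')"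
  proof -
    have "?I (boundaries A f +>\<^bsub>B\<^esub> z) = boundaries A' f' +>\<^bsub>B'\<^esub> \<beta> z" if "z \<in> cycles B g C" for z
      using that by (intro induced_map_coset[OF B.module_axioms boundaries_submodule[OF c] assms(3)
          boundaries_submodule[OF c'] \<beta>(1)]) (auto simp: im)
    then show ?thesis
      unfolding homology_carrier[OF c] homology_carrier[OF c'] ker image_image by (intro image_cong) auto
  qed
  ultimately show ?thesis
    using hom homology_module[OF c] homology_module[OF c']
    by (auto simp: module_isomorphic_def bij_betw_def)
qed


section \<open>Direct sums\<close>

lemma direct_sum_simps:
  "carrier (direct_sum I M) = {x \<in> \<Pi>\<^sub>E i\<in>I. carrier (M i). finite {i \<in> I. x i \<noteq> \<zero>\<^bsub>M i\<^esub>}}"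
  "\<zero>\<^bsub>direct_sum I M\<^esub> = (\<lambda>i\<in>I. \<zero>\<^bsub>M i\<^esub>)"
  "x \<oplus>\<^bsub>direct_sum I M\<^esub> y = (\<lambda>i\<in>I. x i \<oplus>\<^bsub>M i\<^esub> y i)"
  "a \<odot>\<^bsub>direct_sum I M\<^esub> x = (\<lambda>i\<in>I. a \<odot>\<^bsub>M i\<^esub> x i)"
  by (simp_all add: direct_sum_def)

lemma direct_sum_component: "x \<in> carrier (direct_sum I M) \<Longrightarrow> i \<in> I \<Longrightarrow> x i \<in> carrier (M i)"
  by (auto simp: direct_sum_simps)

lemma direct_sum_module:
  assumes "cring R" and M: "\<And>i. i \<in> I \<Longrightarrow> module R (M i)"
  shows "module R (direct_sum I M)"
proof -
  have grp: "abelian_group (M i)" if "i \<in> I" for i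
    using M[OF that] by (simp add: module_def)
  note mon = abelian_group.axioms(1)[OF grp]
  note zero = abelian_monoid.zero_closed[OF mon]
  note add = abelian_monoid.a_closed[OF mon]
  have neg_zero: "\<ominus>\<^bsub>M i\<^esub> \<zero>\<^bsub>M i\<^esub> = \<zero>\<^bsub>M i\<^esub>" if "i \<in> I" for i
    by (rule abelian_group.minus_equality[OF grp[OF that]])
      (simp_all add: that zero abelian_monoid.l_zero[OF mon])
  have fin_add: "finite {i \<in> I. x i \<oplus>\<^bsub>M i\<^esub> y i \<noteq> \<zero>\<^bsub>M i\<^esub>}"
    if "finite {i \<in> I. x i \<noteq> \<zero>\<^bsub>M i\<^esub>}" "finite {i \<in> I. y i \<noteq> \<zero>\<^bsub>M i\<^esub>}" for x y
    by (rule finite_subset[OF _ finite_UnI[OF that]])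
      (auto simp: zero abelian_monoid.l_zero[OF mon])
  have fin_map: "finite {i \<in> I. h i \<noteq> \<zero>\<^bsub>M i\<^esub>}"
    if "finite {i \<in> I. x i \<noteq> \<zero>\<^bsub>M i\<^esub>}" "\<And>i. i \<in> I \<Longrightarrow> x i = \<zero>\<^bsub>M i\<^esub> \<Longrightarrow> h i = \<zero>\<^bsub>M i\<^esub>" for x h
    by (rule finite_subset[OF _ that(1)]) (use that(2) in auto)
  show ?thesis
  proof (rule moduleI)
    show "abelian_group (direct_sum I M)"
    proof (rule abelian_groupI)
      fix x y assume xy: "x \<in> carrier (direct_sum I M)" "y \<in> carrier (direct_sum I M)"
      then show "x \<oplus>\<^bsub>direct_sum I M\<^esub> y \<in> carrier (direct_sum I M)"
        using fin_add[of x y] direct_sum_component[OF xy(1)] direct_sum_component[OF xy(2)]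
        by (auto simp: direct_sum_simps intro: add cong: conj_cong)
      show "x \<oplus>\<^bsub>direct_sum I M\<^esub> y = y \<oplus>\<^bsub>direct_sum I M\<^esub> x"
        unfolding direct_sum_simps(3)
        by (rule restrict_ext, rule abelian_monoid.a_comm[OF mon])
          (simp_all add: direct_sum_component[OF xy(1)] direct_sum_component[OF xy(2)])
    next
      fix x assume x: "x \<in> carrier (direct_sum I M)"
      then show "\<zero>\<^bsub>direct_sum I M\<^esub> \<oplus>\<^bsub>direct_sum I M\<^esub> x = x"
        using direct_sum_component[OF x]
        by (auto simp: direct_sum_simps abelian_monoid.l_zero[OF mon] fun_eq_iff
            intro: PiE_arb[symmetric])
      show "\<exists>y\<in>carrier (direct_sum I M). y \<oplus>\<^bsub>direct_sum I M\<^esub> x = \<zero>\<^bsub>direct_sum I M\<^esub>"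
      proof (rule bexI)
        show "(\<lambda>i\<in>I. \<ominus>\<^bsub>M i\<^esub> x i) \<in> carrier (direct_sum I M)"
          using x fin_map[of x "\<lambda>i. \<ominus>\<^bsub>M i\<^esub> x i"] direct_sum_component[OF x]
          by (auto simp: direct_sum_simps neg_zero abelian_group.a_inv_closed[OF grp] cong: conj_cong)
        show "(\<lambda>i\<in>I. \<ominus>\<^bsub>M i\<^esub> x i) \<oplus>\<^bsub>direct_sum I M\<^esub> x = \<zero>\<^bsub>direct_sum I M\<^esub>"
          using direct_sum_component[OF x] by (auto simp: direct_sum_simps abelian_group.l_neg[OF grp])
      qed
    next
      fix x y z assume "x \<in> carrier (direct_sum I M)" "y \<in> carrier (direct_sum I M)"
        "z \<in> carrier (direct_sum I M)"
      then show "x \<oplus>\<^bsub>direct_sum I M\<^esub> y \<oplus>\<^bsub>direct_sum I M\<^esub> z = x \<oplus>\<^bsub>direct_sum I M\<^esub> (y \<oplus>\<^bsub>direct_sum I M\<^esub> z)"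
        using direct_sum_component[of _ I M]
        by (auto simp: direct_sum_simps(3) abelian_monoid.a_assoc[OF mon])
    qed (auto simp: direct_sum_simps zero cong: conj_cong)
    fix a x assume "a \<in> carrier R" and x: "x \<in> carrier (direct_sum I M)"
    then show "a \<odot>\<^bsub>direct_sum I M\<^esub> x \<in> carrier (direct_sum I M)"
      using fin_map[of x "\<lambda>i. a \<odot>\<^bsub>M i\<^esub> x i"]
        direct_sum_component[OF x]
      by (auto simp: direct_sum_simps module.smult_r_null[OF M] intro: module.smult_closed[OF M] cong: conj_cong)
  next
    fix x assume x: "x \<in> carrier (direct_sum I M)"
    then show "\<one>\<^bsub>R\<^esub> \<odot>\<^bsub>direct_sum I M\<^esub> x = x"
      using direct_sum_component[OF x]
      by (auto simp: direct_sum_simps module.smult_one[OF M] fun_eq_iff intro: PiE_arb[symmetric])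
  qed (use \<open>cring R\<close> direct_sum_component[of _ I M] in
      \<open>auto simp: direct_sum_simps(3,4) module.smult_l_distr[OF M] module.smult_r_distr[OF M]
        module.smult_assoc1[OF M]\<close>)
qed

lemma direct_sum_map_hom:
  assumes M: "\<And>i. i \<in> I \<Longrightarrow> module R (M i)" and N: "\<And>i. i \<in> I \<Longrightarrow> module R (N i)"
    and \<phi>: "\<And>i. i \<in> I \<Longrightarrow> \<phi> i \<in> module_hom R (M i) (N i)"
  shows "(\<lambda>x. \<lambda>i\<in>I. \<phi> i (x i)) \<in> module_hom R (direct_sum I M) (direct_sum I N)"
proof (rule module_homI)
  fix x assume x: "x \<in> carrier (direct_sum I M)"
  have "finite {i \<in> I. \<phi> i (x i) \<noteq> \<zero>\<^bsub>N i\<^esub>}"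
    by (rule finite_subset[of _ "{i \<in> I. x i \<noteq> \<zero>\<^bsub>M i\<^esub>}"])
      (use x module_hom_zero[OF M N \<phi>] in \<open>auto simp: direct_sum_simps\<close>)
  then show "(\<lambda>i\<in>I. \<phi> i (x i)) \<in> carrier (direct_sum I N)"
    using x module_homD(1)[OF \<phi>] by (auto simp: direct_sum_simps PiE_mem cong: conj_cong)
qed (use direct_sum_component[of _ I M] module_homD(2,3)[OF \<phi>] in
    \<open>auto simp: direct_sum_simps(3,4)\<close>)

lemma direct_sum_reindex:
  assumes g: "bij_betw g J I" and N: "\<And>j. j \<in> J \<Longrightarrow> N j = M (g j)"
  shows "(\<lambda>x. \<lambda>j\<in>J. x (g j)) \<in> module_hom R (direct_sum I M) (direct_sum J N)"
    and "bij_betw (\<lambda>x. \<lambda>j\<in>J. x (g j)) (carrier (direct_sum I M)) (carrier (direct_sum J N))"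
proof -
  let ?h = "inv_into J g"
  have gI: "g j \<in> I" "?h (g j) = j" if "j \<in> J" for j
    using g that by (auto simp: bij_betw_def)
  have hJ: "?h i \<in> J" "g (?h i) = i" if "i \<in> I" for i
    using g that by (auto simp: bij_betw_def inv_into_into f_inv_into_f)
  have fwd: "(\<lambda>j\<in>J. x (g j)) \<in> carrier (direct_sum J N)" if x: "x \<in> carrier (direct_sum I M)" for x
  proof -
    have "{j \<in> J. x (g j) \<noteq> \<zero>\<^bsub>N j\<^esub>} \<subseteq> ?h ` {i \<in> I. x i \<noteq> \<zero>\<^bsub>M i\<^esub>}"
      using gI N by force
    then have "finite {j \<in> J. x (g j) \<noteq> \<zero>\<^bsub>N j\<^esub>}"
      by (rule finite_subset) (use x in \<open>auto simp: direct_sum_simps\<close>)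
    then show ?thesis
      using x gI N by (auto simp: direct_sum_simps PiE_mem cong: conj_cong)
  qed
  have bwd: "(\<lambda>i\<in>I. y (?h i)) \<in> carrier (direct_sum I M)" if y: "y \<in> carrier (direct_sum J N)" for y
  proof -
    have "{i \<in> I. y (?h i) \<noteq> \<zero>\<^bsub>M i\<^esub>} \<subseteq> g ` {j \<in> J. y j \<noteq> \<zero>\<^bsub>N j\<^esub>}"
      using hJ N by force
    then have "finite {i \<in> I. y (?h i) \<noteq> \<zero>\<^bsub>M i\<^esub>}"
      by (rule finite_subset) (use y in \<open>auto simp: direct_sum_simps\<close>)
    moreover have "y (?h i) \<in> carrier (M i)" if "i \<in> I" for i
      using hJ[OF that] N[of "?h i"] direct_sum_component[OF y, of "?h i"] by simp
    ultimately show ?thesis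
      by (auto simp: direct_sum_simps cong: conj_cong)
  qed
  show "bij_betw (\<lambda>x. \<lambda>j\<in>J. x (g j)) (carrier (direct_sum I M)) (carrier (direct_sum J N))"
  proof (rule bij_betw_byWitness[where f' = "\<lambda>y. \<lambda>i\<in>I. y (?h i)"])
    show "\<forall>x\<in>carrier (direct_sum I M). (\<lambda>i\<in>I. (\<lambda>j\<in>J. x (g j)) (?h i)) = x"
      using hJ by (auto simp: direct_sum_simps fun_eq_iff intro: PiE_arb[symmetric])
    show "\<forall>y\<in>carrier (direct_sum J N). (\<lambda>j\<in>J. (\<lambda>i\<in>I. y (?h i)) (g j)) = y"
      using gI by (auto simp: direct_sum_simps fun_eq_iff intro: PiE_arb[symmetric])
  qed (use fwd bwd in auto)
  show "(\<lambda>x. \<lambda>j\<in>J. x (g j)) \<in> module_hom R (direct_sum I M) (direct_sum J N)"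
    by (rule module_homI) (use fwd gI N in \<open>auto simp: direct_sum_simps(3,4)\<close>)
qed


section \<open>Finite sums\<close>

lemma (in abelian_monoid) finsum_swap:
  assumes "finite S" and f: "\<And>i j. i \<in> S \<Longrightarrow> j \<in> T \<Longrightarrow> f i j \<in> carrier G"
  shows "(\<Oplus>i\<in>S. \<Oplus>j\<in>T. f i j) = (\<Oplus>j\<in>T. \<Oplus>i\<in>S. f i j)"
  using assms
proof (induct S)
  case empty
  show ?case by simp
next
  case (insert k S)
  have "(\<Oplus>i\<in>insert k S. \<Oplus>j\<in>T. f i j) = (\<Oplus>j\<in>T. f k j) \<oplus> (\<Oplus>j\<in>T. \<Oplus>i\<in>S. f i j)"
    using insert by (subst finsum_insert) (auto intro!: finsum_closed)
  also have "\<dots> = (\<Oplus>j\<in>T. f k j \<oplus> (\<Oplus>i\<in>S. f i j))"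
    using insert by (subst finsum_addf) (auto intro!: finsum_closed)
  also have "\<dots> = (\<Oplus>j\<in>T. \<Oplus>i\<in>insert k S. f i j)"
    using insert by (intro finsum_cong') (auto intro!: finsum_closed)
  finally show ?case .
qed

text \<open>This is how a differential squares to zero: among the paths of length two between two given
  objects at most two contribute, and these cancel.\<close>

lemma (in abelian_monoid) finsum_cancelling_pair:
  assumes "finite S" and f: "f \<in> S \<rightarrow> carrier G"
    and pair: "\<And>y. y \<in> S \<Longrightarrow> f y \<noteq> \<zero> \<Longrightarrow>
      \<exists>y'\<in>S. y' \<noteq> y \<and> f y \<oplus> f y' = \<zero> \<and> (\<forall>w\<in>S - {y, y'}. f w = \<zero>)"
  shows "(\<Oplus>y\<in>S. f y) = \<zero>"
proof (cases "\<exists>y\<in>S. f y \<noteq> \<zero>")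
  case True
  then obtain y y' where y: "y \<in> S" "y' \<in> S" "y' \<noteq> y" "f y \<oplus> f y' = \<zero>"
    and rest: "\<forall>w\<in>S - {y, y'}. f w = \<zero>"
    using pair by blast
  have "(\<Oplus>y\<in>S. f y) = (\<Oplus>w\<in>{y, y'}. f w)"
    using y rest assms(1) f by (intro add.finprod_mono_neutral_cong_right) auto
  also have "\<dots> = \<zero>"
    using y f by (auto simp: Pi_def)
  finally show ?thesis .
qed (simp add: add.finprod_one_eqI)


section \<open>Poset cochains\<close>

lemma sign_scalar_closed: "cring R \<Longrightarrow> sign_scalar R t \<in> carrier R"
  by (simp add: sign_scalar_def cring_def ring.ring_simprules)

lemma sign_scalar_opposite:
  assumes "cring R" "t + u = t' + u' + 1"
  shows "sign_scalar R u \<otimes>\<^bsub>R\<^esub> sign_scalar R t = \<ominus>\<^bsub>R\<^esub> (sign_scalar R u' \<otimes>\<^bsub>R\<^esub> sign_scalar R t')"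
proof -
  interpret cring R by fact
  show ?thesis
    using assms(2)
    by (cases t; cases u; cases t'; cases u') (auto simp: sign_scalar_def l_minus r_minus)
qed

lemma covers_in_poset: "covers P r x y \<Longrightarrow> x \<in> P \<and> y \<in> P \<and> (x, y) \<in> r"
  by (simp add: covers_def)

context
  fixes R P r rk s Ob Mor
  assumes R: "cring R" and sq: "squared_poset P r rk" and sgn: "sign_assignment P r s"
    and func: "functor_to_modules R P r Ob Mor"
begin

interpretation R: cring R by (rule R)

text \<open>The differential is rewritten as a sum over all elements of the given rank, so that the two
  sums in its square can be interchanged.\<close>

private definition entry where
  "entry x y a = (if covers P r x y then sign_scalar R (s x y) \<odot>\<^bsub>Ob y\<^esub> Mor x y a else \<zero>\<^bsub>Ob y\<^esub>)"

private lemma Ob: "x \<in> P \<Longrightarrow> module R (Ob x)"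
  using func by (simp add: functor_to_modules_def)

private lemma Mor_hom: "covers P r x y \<Longrightarrow> Mor x y \<in> module_hom R (Ob x) (Ob y)"
  using func by (simp add: functor_to_modules_def covers_def)

private lemma entry_hom:
  assumes "x \<in> P" "y \<in> P"
  shows "entry x y \<in> module_hom R (Ob x) (Ob y)"
proof (cases "covers P r x y")
  case True
  then have "entry x y = (\<lambda>a. sign_scalar R (s x y) \<odot>\<^bsub>Ob y\<^esub> Mor x y a)"
    by (simp add: entry_def fun_eq_iff)
  then show ?thesis
    using module_hom_smult[OF Ob Ob Mor_hom sign_scalar_closed[OF R], OF assms True] by simp
next
  case False
  then have "entry x y = (\<lambda>_. \<zero>\<^bsub>Ob y\<^esub>)"
    by (simp add: entry_def fun_eq_iff)
  then show ?thesis
    using module_hom_zero_map[OF Ob Ob, OF assms] by simp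
qed

private lemma cochain_component:
  "a \<in> carrier (poset_cochains P rk Ob n) \<Longrightarrow> x \<in> P \<Longrightarrow> rk x = n \<Longrightarrow> a x \<in> carrier (Ob x)"
  using direct_sum_component[of a "{x \<in> P. rk x = n}" Ob x] by (simp add: poset_cochains_def)

private lemma entry_cochain_closed:
  assumes "a \<in> carrier (poset_cochains P rk Ob n)" "x \<in> P" "rk x = n" "y \<in> P"
  shows "entry x y (a x) \<in> carrier (Ob y)"
  by (rule module_homD(1)[OF entry_hom[OF assms(2,4)] cochain_component[OF assms(1-3)]])

private lemma finite_P: "finite P"
  using sq by (simp add: squared_poset_def)

private lemma differential_entries:
  assumes "a \<in> carrier (poset_cochains P rk Ob n)" "y \<in> P" "rk y = n + 1"
  shows "poset_differential R P r rk s Ob Mor n a y = (\<Oplus>\<^bsub>Ob y\<^esub>x\<in>{x \<in> P. rk x = n}. entry x y (a x))"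
proof -
  interpret Y: module R "Ob y" by (rule Ob) fact
  have closed: "entry x y (a x) \<in> carrier (Ob y)" if "x \<in> P" "rk x = n" for x
    by (rule entry_cochain_closed[OF assms(1) that assms(2)])
  have "poset_differential R P r rk s Ob Mor n a y
      = (\<Oplus>\<^bsub>Ob y\<^esub>x\<in>{x \<in> P. rk x = n \<and> covers P r x y}. sign_scalar R (s x y) \<odot>\<^bsub>Ob y\<^esub> Mor x y (a x))"
    using assms(2,3) by (simp add: poset_differential_def)
  also have "\<dots> = (\<Oplus>\<^bsub>Ob y\<^esub>x\<in>{x \<in> P. rk x = n}. entry x y (a x))"
  proof (rule Y.add.finprod_mono_neutral_cong_left)
    show "finite {x \<in> P. rk x = n}" using finite_P by simp
    show "(\<lambda>x. entry x y (a x)) \<in> {x \<in> P. rk x = n} \<rightarrow> carrier (Ob y)"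
      using closed by blast
  qed (auto simp: entry_def)
  finally show ?thesis .
qed

text \<open>Either no element covers \<open>x\<close> and is covered by \<open>z\<close>, or there are exactly two, the middle corners
  of a square; by functoriality both corners contribute the same map up to sign, and
  the sign condition makes the signs opposite.\<close>

private lemma entry_square_zero:
  assumes "x \<in> P" "z \<in> P" "a \<in> carrier (Ob x)" "rk x = n"
  shows "(\<Oplus>\<^bsub>Ob z\<^esub>y\<in>{y \<in> P. rk y = n + 1}. entry y z (entry x y a)) = \<zero>\<^bsub>Ob z\<^esub>"
proof -
  interpret Z: module R "Ob z" by (rule Ob) fact
  have closed: "entry y z (entry x y a) \<in> carrier (Ob z)" if "y \<in> P" for y
    by (intro module_homD(1)[OF entry_hom] that assms)
  have off: "entry y z (entry x y a) = \<zero>\<^bsub>Ob z\<^esub>" if "y \<in> P" "\<not> (covers P r x y \<and> covers P r y z)" for y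
    using that module_hom_zero[OF Ob Ob entry_hom, of y z] assms by (auto simp: entry_def)
  have on: "entry y z (entry x y a)
      = (sign_scalar R (s y z) \<otimes>\<^bsub>R\<^esub> sign_scalar R (s x y)) \<odot>\<^bsub>Ob z\<^esub> Mor x z a \<and> Mor x z a \<in> carrier (Ob z)"
    if c: "covers P r x y" "covers P r y z" for y
  proof -
    have M: "Mor x y a \<in> carrier (Ob y)" by (rule module_homD(1)[OF Mor_hom[OF c(1)] assms(3)])
    have "Mor x z a = Mor y z (Mor x y a)"
      using func c assms(3) by (auto simp: functor_to_modules_def covers_def)
    moreover have "Mor y z (Mor x y a) \<in> carrier (Ob z)"
      by (rule module_homD(1)[OF Mor_hom[OF c(2)] M])
    ultimately show ?thesis
      using c M by (simp add: entry_def module_homD(3)[OF Mor_hom[OF c(2)]]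
          sign_scalar_closed[OF R] Z.smult_assoc1)
  qed
  show ?thesis
  proof (rule Z.finsum_cancelling_pair)
    fix y assume y: "y \<in> {y \<in> P. rk y = n + 1}" "entry y z (entry x y a) \<noteq> \<zero>\<^bsub>Ob z\<^esub>"
    then have c: "covers P r x y" "covers P r y z" using off by blast+
    then have "\<exists>!y'. y' \<noteq> y \<and> covers P r x y' \<and> covers P r y' z"
      using sq unfolding squared_poset_def by blast
    then obtain y' where y': "y' \<noteq> y" "covers P r x y'" "covers P r y' z"
      and uniq: "\<And>w. w \<noteq> y \<Longrightarrow> covers P r x w \<Longrightarrow> covers P r w z \<Longrightarrow> w = y'"
      by blast
    have "s x y + s y z = s x y' + s y' z + 1"
      using sgn c y' unfolding sign_assignment_def by blast
    note opp = sign_scalar_opposite[OF R this]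
    have "entry y z (entry x y a) \<oplus>\<^bsub>Ob z\<^esub> entry y' z (entry x y' a) = \<zero>\<^bsub>Ob z\<^esub>"
      using on[OF c] on[OF y'(2,3)] sign_scalar_closed[OF R]
      by (simp add: opp Z.smult_l_minus Z.M.l_neg)
    moreover have "y' \<in> {y \<in> P. rk y = n + 1}"
      using y'(2) sq assms(4) unfolding squared_poset_def covers_def by auto
    moreover have "\<forall>w\<in>{y \<in> P. rk y = n + 1} - {y, y'}. entry w z (entry x w a) = \<zero>\<^bsub>Ob z\<^esub>"
      using off uniq by blast
    ultimately show "\<exists>y'\<in>{y \<in> P. rk y = n + 1}. y' \<noteq> y \<and>
        entry y z (entry x y a) \<oplus>\<^bsub>Ob z\<^esub> entry y' z (entry x y' a) = \<zero>\<^bsub>Ob z\<^esub> \<and>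
        (\<forall>w\<in>{y \<in> P. rk y = n + 1} - {y, y'}. entry w z (entry x w a) = \<zero>\<^bsub>Ob z\<^esub>)"
      using y'(1) by blast
  qed (use finite_P closed in auto)
qed

lemma poset_cochains_module: "module R (poset_cochains P rk Ob n)"
  unfolding poset_cochains_def by (rule direct_sum_module) (auto simp: R Ob)

lemma poset_differential_hom:
  "poset_differential R P r rk s Ob Mor n \<in> module_hom R (poset_cochains P rk Ob n) (poset_cochains P rk Ob (n + 1))"
proof (rule module_homI)
  let ?d = "poset_differential R P r rk s Ob Mor n"
  have outside: "?d a y = undefined" if "y \<notin> {y \<in> P. rk y = n + 1}" for a y
    using that by (auto simp: poset_differential_def)
  have comp: "entry x y (a x) \<in> carrier (Ob y)"
    if "a \<in> carrier (poset_cochains P rk Ob n)" "x \<in> P" "rk x = n" "y \<in> P" for a x y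
    by (rule entry_cochain_closed) fact+
  fix a assume a: "a \<in> carrier (poset_cochains P rk Ob n)"
  have ax: "a x \<in> carrier (Ob x)" if "x \<in> P" "rk x = n" for x
    by (rule cochain_component[OF a that])
  have "?d a y \<in> carrier (Ob y)" if "y \<in> P" "rk y = n + 1" for y
  proof -
    interpret Y: module R "Ob y" by (rule Ob) fact
    show ?thesis using that comp[OF a] by (auto simp: differential_entries[OF a] intro!: Y.finsum_closed)
  qed
  then show "?d a \<in> carrier (poset_cochains P rk Ob (n + 1))"
    using finite_P outside by (auto simp: poset_cochains_def direct_sum_simps PiE_def extensional_def)
  show "?d (a \<oplus>\<^bsub>poset_cochains P rk Ob n\<^esub> b) = ?d a \<oplus>\<^bsub>poset_cochains P rk Ob (n + 1)\<^esub> ?d b"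
    if b: "b \<in> carrier (poset_cochains P rk Ob n)" for b
  proof (rule ext)
    fix y
    have ab: "a \<oplus>\<^bsub>poset_cochains P rk Ob n\<^esub> b \<in> carrier (poset_cochains P rk Ob n)"
      using module.axioms(2)[OF poset_cochains_module] a b
      by (simp add: abelian_group_def abelian_monoid.a_closed)
    have bx: "b x \<in> carrier (Ob x)" if "x \<in> P" "rk x = n" for x
      by (rule cochain_component[OF b that])
    show "?d (a \<oplus>\<^bsub>poset_cochains P rk Ob n\<^esub> b) y = (?d a \<oplus>\<^bsub>poset_cochains P rk Ob (n + 1)\<^esub> ?d b) y"
    proof (cases "y \<in> {y \<in> P. rk y = n + 1}")
      case True
      then have yP: "y \<in> P" "rk y = n + 1" by auto
      interpret Y: module R "Ob y" by (rule Ob[OF yP(1)])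
      have "?d (a \<oplus>\<^bsub>poset_cochains P rk Ob n\<^esub> b) y
          = (\<Oplus>\<^bsub>Ob y\<^esub>x\<in>{x \<in> P. rk x = n}. entry x y (a x) \<oplus>\<^bsub>Ob y\<^esub> entry x y (b x))"
        using True comp[OF a] comp[OF b]
        unfolding differential_entries[OF ab yP]
        by (intro Y.finsum_cong')
          (auto simp: poset_cochains_def direct_sum_simps(3) ax bx module_homD(2)[OF entry_hom])
      also have "\<dots> = ?d a y \<oplus>\<^bsub>Ob y\<^esub> ?d b y"
        using True comp[OF a] comp[OF b] by (simp add: differential_entries a b Y.finsum_addf Pi_def)
      finally show ?thesis using True by (simp add: poset_cochains_def direct_sum_simps(3))
    qed (auto simp: outside poset_cochains_def direct_sum_simps(3))
  qed
  show "?d (c \<odot>\<^bsub>poset_cochains P rk Ob n\<^esub> a) = c \<odot>\<^bsub>poset_cochains P rk Ob (n + 1)\<^esub> ?d a"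
    if c: "c \<in> carrier R" for c
  proof (rule ext)
    fix y
    have ca: "c \<odot>\<^bsub>poset_cochains P rk Ob n\<^esub> a \<in> carrier (poset_cochains P rk Ob n)"
      by (rule module.smult_closed[OF poset_cochains_module c a])
    show "?d (c \<odot>\<^bsub>poset_cochains P rk Ob n\<^esub> a) y = (c \<odot>\<^bsub>poset_cochains P rk Ob (n + 1)\<^esub> ?d a) y"
    proof (cases "y \<in> {y \<in> P. rk y = n + 1}")
      case True
      then interpret Y: module R "Ob y" by (intro Ob) auto
      have "?d (c \<odot>\<^bsub>poset_cochains P rk Ob n\<^esub> a) y
          = (\<Oplus>\<^bsub>Ob y\<^esub>x\<in>{x \<in> P. rk x = n}. c \<odot>\<^bsub>Ob y\<^esub> entry x y (a x))"
        using True ca comp[OF a] ax c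
        by (auto simp: differential_entries poset_cochains_def direct_sum_simps(4)
            module_homD(3)[OF entry_hom] intro!: Y.finsum_cong')
      also have "\<dots> = c \<odot>\<^bsub>Ob y\<^esub> ?d a y"
        using True comp[OF a] finite_P
        by (simp add: differential_entries a c Y.finsum_smult_ldistr Pi_def)
      finally show ?thesis using True by (simp add: poset_cochains_def direct_sum_simps(4))
    qed (auto simp: outside poset_cochains_def direct_sum_simps(4))
  qed
qed

lemma poset_differential_square_zero:
  assumes a: "a \<in> carrier (poset_cochains P rk Ob n)"
  shows "poset_differential R P r rk s Ob Mor (n + 1) (poset_differential R P r rk s Ob Mor n a)
    = \<zero>\<^bsub>poset_cochains P rk Ob (n + 1 + 1)\<^esub>"
proof (rule ext)
  fix z
  let ?d = "poset_differential R P r rk s Ob Mor n"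
  let ?d' = "poset_differential R P r rk s Ob Mor (n + 1)"
  have da: "?d a \<in> carrier (poset_cochains P rk Ob (n + 1))"
    by (rule module_homD(1)[OF poset_differential_hom a])
  have ax: "a x \<in> carrier (Ob x)" if "x \<in> P" "rk x = n" for x
    by (rule cochain_component[OF a that])
  have exy: "entry x y (a x) \<in> carrier (Ob y)" if "x \<in> P" "rk x = n" "y \<in> P" for x y
    by (rule entry_cochain_closed[OF a that])
  show "?d' (?d a) z = \<zero>\<^bsub>poset_cochains P rk Ob (n + 1 + 1)\<^esub> z"
  proof (cases "z \<in> {z \<in> P. rk z = n + 1 + 1}")
    case True
    then interpret Z: module R "Ob z" by (intro Ob) auto
    have zP: "z \<in> P" using True by simp
    have closed: "entry y z (entry x y (a x)) \<in> carrier (Ob z)" if "x \<in> P" "rk x = n" "y \<in> P" for x y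
      by (rule module_homD(1)[OF entry_hom[OF that(3) zP] exy[OF that]])
    have "?d' (?d a) z = (\<Oplus>\<^bsub>Ob z\<^esub>y\<in>{y \<in> P. rk y = n + 1}. entry y z (?d a y))"
      using True by (intro differential_entries da) auto
    also have "\<dots> = (\<Oplus>\<^bsub>Ob z\<^esub>y\<in>{y \<in> P. rk y = n + 1}.
        \<Oplus>\<^bsub>Ob z\<^esub>x\<in>{x \<in> P. rk x = n}. entry y z (entry x y (a x)))"
    proof (rule Z.finsum_cong')
      fix y assume y: "y \<in> {y \<in> P. rk y = n + 1}"
      then have "entry y z (?d a y) = entry y z (\<Oplus>\<^bsub>Ob y\<^esub>x\<in>{x \<in> P. rk x = n}. entry x y (a x))"
        using a by (simp add: differential_entries)
      also have "\<dots> = (\<Oplus>\<^bsub>Ob z\<^esub>x\<in>{x \<in> P. rk x = n}. entry y z (entry x y (a x)))"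
        using y zP exy by (intro module_hom_finsum[OF Ob Ob entry_hom]) auto
      finally show "entry y z (?d a y) = (\<Oplus>\<^bsub>Ob z\<^esub>x\<in>{x \<in> P. rk x = n}. entry y z (entry x y (a x)))" .
    qed (use closed in \<open>auto intro!: Z.finsum_closed\<close>)
    also have "\<dots> = (\<Oplus>\<^bsub>Ob z\<^esub>x\<in>{x \<in> P. rk x = n}.
        \<Oplus>\<^bsub>Ob z\<^esub>y\<in>{y \<in> P. rk y = n + 1}. entry y z (entry x y (a x)))"
      using finite_P closed by (intro Z.finsum_swap) auto
    also have "\<dots> = \<zero>\<^bsub>Ob z\<^esub>"
      using zP ax by (intro Z.add.finprod_one_eqI entry_square_zero) auto
    finally show ?thesis using True by (simp add: poset_cochains_def direct_sum_simps(2))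
  qed (auto simp: poset_cochains_def direct_sum_simps(2) poset_differential_def)
qed

lemma poset_complex_at:
  "complex_at R
    (poset_cochains P rk Ob (n - 1)) (poset_differential R P r rk s Ob Mor (n - 1))
    (poset_cochains P rk Ob n) (poset_differential R P r rk s Ob Mor n)
    (poset_cochains P rk Ob (n + 1))"
  using poset_cochains_module poset_differential_hom[of "n - 1"] poset_differential_hom[of n]
    poset_differential_square_zero[of _ "n - 1"]
  by (simp add: complex_at_def)

end


section \<open>Chains\<close>

lemma ring_as_module_simps [simp]:
  "carrier (ring_as_module R) = carrier R" "\<zero>\<^bsub>ring_as_module R\<^esub> = \<zero>\<^bsub>R\<^esub>"
  "x \<oplus>\<^bsub>ring_as_module R\<^esub> y = x \<oplus>\<^bsub>R\<^esub> y" "a \<odot>\<^bsub>ring_as_module R\<^esub> x = a \<otimes>\<^bsub>R\<^esub> x"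
  by (simp_all add: ring_as_module_def)

lemma ring_as_module_module:
  assumes "cring R"
  shows "module R (ring_as_module R)"
proof -
  interpret cring R by fact
  show ?thesis
  proof (rule moduleI)
    show "abelian_group (ring_as_module R)"
      by (rule abelian_groupI) (auto simp: a_ac intro: l_neg)
  qed (auto simp: cring_axioms l_distr r_distr m_assoc)
qed

lemma chains_module: "cring R \<Longrightarrow> module R (chains R X k)"
  unfolding chains_def by (rule direct_sum_module) (auto intro: ring_as_module_module)

lemma finite_simplices: "finite_simplicial_complex X \<Longrightarrow> finite (simplices X k)"
  by (simp add: finite_simplicial_complex_def simplices_def)

lemma chains_carrier:
  "finite_simplicial_complex X \<Longrightarrow> carrier (chains R X k) = simplices X k \<rightarrow>\<^sub>E carrier R"
  by (auto simp: chains_def direct_sum_simps finite_simplices)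

lemma chain_coefficient: "c \<in> carrier (chains R X k) \<Longrightarrow> \<sigma> \<in> simplices X k \<Longrightarrow> c \<sigma> \<in> carrier R"
  using direct_sum_component[of c "simplices X k" "\<lambda>_. ring_as_module R" \<sigma>] by (simp add: chains_def)

lemma chains_ops:
  "c \<oplus>\<^bsub>chains R X k\<^esub> d = (\<lambda>\<sigma>\<in>simplices X k. c \<sigma> \<oplus>\<^bsub>R\<^esub> d \<sigma>)"
  "a \<odot>\<^bsub>chains R X k\<^esub> c = (\<lambda>\<sigma>\<in>simplices X k. a \<otimes>\<^bsub>R\<^esub> c \<sigma>)"
  "\<zero>\<^bsub>chains R X k\<^esub> = (\<lambda>\<sigma>\<in>simplices X k. \<zero>\<^bsub>R\<^esub>)"
  by (simp_all add: chains_def direct_sum_simps cong: restrict_cong)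


section \<open>Weights and the matrix of the horizontal boundary\<close>

text \<open>The matrix of the horizontal boundary, filled up with zeros where the weight changes. This makes
  the range of summation independent of the target simplex.\<close>

definition horizontal_incidence ::
    "('r, 'x) ring_scheme \<Rightarrow> 'v set set \<Rightarrow> (nat \<Rightarrow> 'v) \<Rightarrow> ('v \<Rightarrow> int) \<Rightarrow> 'v set \<Rightarrow> 'v set \<Rightarrow> 'r" where
  "horizontal_incidence R X v \<epsilon> \<sigma> \<tau> =
    (if weight \<epsilon> \<sigma> = weight \<epsilon> \<tau> then incidence R X v \<sigma> \<tau> else \<zero>\<^bsub>R\<^esub>)"

lemma weight_eq_sum: "weight \<epsilon> \<sigma> = (\<Sum>u\<in>\<sigma>. 1 - \<epsilon> u)"
  by (simp add: weight_def simplex_dim_def sum_subtractf)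

lemma weight_remove:
  assumes "finite \<sigma>" "u \<in> \<sigma>"
  shows "weight \<epsilon> \<sigma> = weight \<epsilon> (\<sigma> - {u}) \<longleftrightarrow> \<epsilon> u = 1"
  using assms by (auto simp: weight_eq_sum sum.remove)

lemma weight_antimono:
  assumes "\<And>u. u \<in> \<sigma> \<Longrightarrow> \<epsilon> u \<le> \<epsilon>' u"
  shows "weight \<epsilon>' \<sigma> \<le> weight \<epsilon> \<sigma>"
  using assms by (auto simp: weight_eq_sum intro: sum_mono)

lemma weight_eq_iff:
  assumes "finite \<sigma>" "\<And>u. u \<in> \<sigma> \<Longrightarrow> \<epsilon> u \<le> \<epsilon>' u"
  shows "weight \<epsilon> \<sigma> = weight \<epsilon>' \<sigma> \<longleftrightarrow> (\<forall>u\<in>\<sigma>. \<epsilon> u = \<epsilon>' u)"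
proof -
  have "weight \<epsilon> \<sigma> = weight \<epsilon>' \<sigma> \<longleftrightarrow> (\<Sum>u\<in>\<sigma>. \<epsilon>' u - \<epsilon> u) = 0"
    by (auto simp: weight_def sum_subtractf)
  also have "\<dots> \<longleftrightarrow> (\<forall>u\<in>\<sigma>. \<epsilon>' u - \<epsilon> u = 0)"
    using assms by (intro sum_nonneg_eq_0_iff) auto
  finally show ?thesis by auto
qed

locale cring_char_two = cring +
  assumes one_plus_one: "\<one> \<oplus> \<one> = \<zero>"
begin

lemma minus_one: "\<ominus> \<one> = \<one>"
  using one_plus_one by (metis minus_equality one_closed)

lemma incidence_eq: "incidence R X v \<sigma> \<tau> = (if \<exists>u\<in>\<sigma>. \<tau> = \<sigma> - {u} then \<one> else \<zero>)"
proof (cases "\<exists>u\<in>\<sigma>. \<tau> = \<sigma> - {u}")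
  case True
  then obtain u where "u \<in> \<sigma>" "{u \<in> \<sigma>. \<tau> = \<sigma> - {u}} = {u}" by blast
  with True show ?thesis
    by (simp add: incidence_def minus_one nat_pow_one)
next
  case False
  then have "{u \<in> \<sigma>. \<tau> = \<sigma> - {u}} = {}" by blast
  with False show ?thesis by (simp only: incidence_def) simp
qed

lemma horizontal_incidence_eq:
  assumes "finite \<sigma>"
  shows "horizontal_incidence R X v \<epsilon> \<sigma> \<tau> = (if \<exists>u\<in>\<sigma>. \<tau> = \<sigma> - {u} \<and> \<epsilon> u = 1 then \<one> else \<zero>)"
  using weight_remove[OF assms] by (auto simp: horizontal_incidence_def incidence_eq)

lemma horizontal_incidence_closed: "horizontal_incidence R X v \<epsilon> \<sigma> \<tau> \<in> carrier R"
  by (simp add: horizontal_incidence_def incidence_eq)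

end

locale horizontal_complex = cring_char_two +
  fixes X :: "'v set set" and v :: "nat \<Rightarrow> 'v"
  assumes complex: "finite_simplicial_complex X"
begin

abbreviation "inc \<equiv> horizontal_incidence R X v"
abbreviation "bd \<equiv> horizontal_boundary R X v"
abbreviation "Ch \<equiv> chains R X"

lemma simplexD: "\<sigma> \<in> simplices X k \<Longrightarrow> finite \<sigma> \<and> \<sigma> \<in> X \<and> \<sigma> \<subseteq> vertices X"
  using complex by (auto simp: finite_simplicial_complex_def simplices_def vertices_def)

lemma face_simplex:
  assumes "\<sigma> \<in> simplices X k" "u \<in> \<sigma>" "\<sigma> - {u} \<noteq> {}"
  shows "\<sigma> - {u} \<in> simplices X (k - 1)"
proof -
  have "\<forall>\<tau>. \<tau> \<subseteq> \<sigma> \<and> \<tau> \<noteq> {} \<longrightarrow> \<tau> \<in> X"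
    using simplexD[OF assms(1)] complex by (auto simp only: finite_simplicial_complex_def)
  then have "\<sigma> - {u} \<in> X"
    using assms(3) by (meson Diff_subset)
  moreover have "card \<sigma> = Suc (card (\<sigma> - {u}))"
    using simplexD[OF assms(1)] assms(2) by (simp only: card.remove)
  ultimately show ?thesis using assms(1) by (simp add: simplices_def simplex_dim_def)
qed

lemma boundary_coefficient:
  assumes c: "c \<in> carrier (Ch k)" and \<tau>: "\<tau> \<in> simplices X (k - 1)"
  shows "bd \<epsilon> k c \<tau> = (\<Oplus>\<sigma>\<in>simplices X k. c \<sigma> \<otimes> inc \<epsilon> \<sigma> \<tau>)"
proof -
  have "bd \<epsilon> k c \<tau>
      = (\<Oplus>\<sigma>\<in>{\<sigma> \<in> simplices X k. weight \<epsilon> \<sigma> = weight \<epsilon> \<tau>}. c \<sigma> \<otimes> incidence R X v \<sigma> \<tau>)"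
    using \<tau> by (simp add: horizontal_boundary_def)
  also have "\<dots> = (\<Oplus>\<sigma>\<in>simplices X k. c \<sigma> \<otimes> inc \<epsilon> \<sigma> \<tau>)"
    by (rule add.finprod_mono_neutral_cong_left)
      (auto simp: horizontal_incidence_def finite_simplices[OF complex] chain_coefficient[OF c] incidence_eq)
  finally show ?thesis .
qed

lemma boundary_outside: "\<tau> \<notin> simplices X (k - 1) \<Longrightarrow> bd \<epsilon> k c \<tau> = undefined"
  by (simp add: horizontal_boundary_def)

lemma boundary_hom: "bd \<epsilon> k \<in> module_hom R (Ch k) (Ch (k - 1))"
proof (rule module_homI)
  fix c assume c: "c \<in> carrier (Ch k)"
  note cc = chain_coefficient[OF c]
  show bdc: "bd \<epsilon> k c \<in> carrier (Ch (k - 1))"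
    using cc by (auto simp: chains_carrier[OF complex] boundary_coefficient[OF c] boundary_outside
        horizontal_incidence_closed PiE_def extensional_def intro!: finsum_closed)
  show "bd \<epsilon> k (c \<oplus>\<^bsub>Ch k\<^esub> d) = bd \<epsilon> k c \<oplus>\<^bsub>Ch (k - 1)\<^esub> bd \<epsilon> k d" if d: "d \<in> carrier (Ch k)" for d
  proof (rule ext)
    fix \<tau>
    interpret K: module R "Ch k" by (rule chains_module) (rule cring_axioms)
    note dd = chain_coefficient[OF d]
    show "bd \<epsilon> k (c \<oplus>\<^bsub>Ch k\<^esub> d) \<tau> = (bd \<epsilon> k c \<oplus>\<^bsub>Ch (k - 1)\<^esub> bd \<epsilon> k d) \<tau>"
    proof (cases "\<tau> \<in> simplices X (k - 1)")
      case True
      have "bd \<epsilon> k (c \<oplus>\<^bsub>Ch k\<^esub> d) \<tau>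
          = (\<Oplus>\<sigma>\<in>simplices X k. c \<sigma> \<otimes> inc \<epsilon> \<sigma> \<tau> \<oplus> d \<sigma> \<otimes> inc \<epsilon> \<sigma> \<tau>)"
        unfolding boundary_coefficient[OF K.a_closed[OF c d] True]
        by (rule finsum_cong') (auto simp: chains_ops cc dd horizontal_incidence_closed l_distr)
      also have "\<dots> = bd \<epsilon> k c \<tau> \<oplus> bd \<epsilon> k d \<tau>"
        unfolding boundary_coefficient[OF c True] boundary_coefficient[OF d True]
        by (rule finsum_addf) (auto simp: cc dd horizontal_incidence_closed)
      finally show ?thesis using True by (simp add: chains_ops)
    qed (simp add: boundary_outside chains_ops)
  qed
  show "bd \<epsilon> k (a \<odot>\<^bsub>Ch k\<^esub> c) = a \<odot>\<^bsub>Ch (k - 1)\<^esub> bd \<epsilon> k c" if a: "a \<in> carrier R" for a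
  proof (rule ext)
    fix \<tau>
    interpret K: module R "Ch k" by (rule chains_module) (rule cring_axioms)
    show "bd \<epsilon> k (a \<odot>\<^bsub>Ch k\<^esub> c) \<tau> = (a \<odot>\<^bsub>Ch (k - 1)\<^esub> bd \<epsilon> k c) \<tau>"
    proof (cases "\<tau> \<in> simplices X (k - 1)")
      case True
      have "bd \<epsilon> k (a \<odot>\<^bsub>Ch k\<^esub> c) \<tau> = (\<Oplus>\<sigma>\<in>simplices X k. a \<otimes> (c \<sigma> \<otimes> inc \<epsilon> \<sigma> \<tau>))"
        unfolding boundary_coefficient[OF K.smult_closed[OF a c] True]
        by (rule finsum_cong') (auto simp: a chains_ops cc horizontal_incidence_closed m_assoc)
      also have "\<dots> = a \<otimes> bd \<epsilon> k c \<tau>"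
        unfolding boundary_coefficient[OF c True]
        by (rule finsum_rdistr[symmetric])
          (auto simp: a cc horizontal_incidence_closed finite_simplices[OF complex])
      finally show ?thesis using True by (simp add: chains_ops)
    qed (simp add: boundary_outside chains_ops)
  qed
qed

text \<open>Between \<open>\<sigma>\<close> and its face \<open>\<sigma> - {u, w}\<close> lie exactly \<open>\<sigma> - {u}\<close> and \<open>\<sigma> - {w}\<close>. A path through one
  of them is horizontal iff both \<open>u\<close> and \<open>w\<close> have colour \<open>1\<close>, so the path through the other one is
  horizontal as well.\<close>

lemma incidence_square_zero:
  assumes \<sigma>: "\<sigma> \<in> simplices X k" and \<rho>: "\<rho> \<noteq> {}"
  shows "(\<Oplus>\<tau>\<in>simplices X (k - 1). inc \<epsilon> \<sigma> \<tau> \<otimes> inc \<epsilon> \<tau> \<rho>) = \<zero>"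
proof (rule finsum_cancelling_pair)
  have entry: "inc \<epsilon> \<sigma> \<tau> \<otimes> inc \<epsilon> \<tau> \<rho> =
      (if \<exists>u\<in>\<sigma>. \<exists>w\<in>\<tau>. \<tau> = \<sigma> - {u} \<and> \<epsilon> u = 1 \<and> \<rho> = \<tau> - {w} \<and> \<epsilon> w = 1 then \<one> else \<zero>)"
    if "\<tau> \<in> simplices X (k - 1)" for \<tau>
    using simplexD[OF \<sigma>] simplexD[OF that] by (auto simp: horizontal_incidence_eq)
  fix \<tau> assume \<tau>: "\<tau> \<in> simplices X (k - 1)" and nz: "inc \<epsilon> \<sigma> \<tau> \<otimes> inc \<epsilon> \<tau> \<rho> \<noteq> \<zero>"
  have "\<exists>u\<in>\<sigma>. \<exists>w\<in>\<tau>. \<tau> = \<sigma> - {u} \<and> \<epsilon> u = 1 \<and> \<rho> = \<tau> - {w} \<and> \<epsilon> w = 1"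
    by (rule ccontr) (use nz in \<open>simp only: entry[OF \<tau>] if_False simp_thms\<close>)
  then obtain u w where uw: "u \<in> \<sigma>" "w \<in> \<sigma>" "u \<noteq> w" "\<epsilon> u = 1" "\<epsilon> w = 1" "\<tau> = \<sigma> - {u}" "\<rho> = \<sigma> - {u} - {w}"
    by blast
  let ?\<tau>' = "\<sigma> - {w}"
  have \<tau>': "?\<tau>' \<in> simplices X (k - 1)"
    by (rule face_simplex[OF \<sigma> uw(2)]) (use uw in auto)
  have "inc \<epsilon> \<sigma> \<tau> \<otimes> inc \<epsilon> \<tau> \<rho> = \<one>"
    unfolding entry[OF \<tau>] using uw by auto
  moreover have "inc \<epsilon> \<sigma> ?\<tau>' \<otimes> inc \<epsilon> ?\<tau>' \<rho> = \<one>"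
  proof -
    have "u \<in> ?\<tau>'" "\<rho> = ?\<tau>' - {u}" using uw by auto
    with uw show ?thesis unfolding entry[OF \<tau>'] by auto
  qed
  moreover have "inc \<epsilon> \<sigma> t \<otimes> inc \<epsilon> t \<rho> = \<zero>" if t: "t \<in> simplices X (k - 1) - {\<tau>, ?\<tau>'}" for t
  proof -
    have "\<not> (\<exists>u'\<in>\<sigma>. \<exists>w'\<in>t. t = \<sigma> - {u'} \<and> \<epsilon> u' = 1 \<and> \<rho> = t - {w'} \<and> \<epsilon> w' = 1)"
    proof (intro notI, elim bexE conjE)
      fix u' w' assume "u' \<in> \<sigma>" "t = \<sigma> - {u'}" "\<rho> = t - {w'}"
      then have "u' \<in> \<sigma> - \<rho>" by blast
      then have "u' = u \<or> u' = w" using uw by blast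
      then show False using t uw \<open>t = \<sigma> - {u'}\<close> by blast
    qed
    then show ?thesis using t by (subst entry) auto
  qed
  moreover have "?\<tau>' \<noteq> \<tau>" using uw by blast
  ultimately show "\<exists>\<tau>'\<in>simplices X (k - 1). \<tau>' \<noteq> \<tau> \<and>
      inc \<epsilon> \<sigma> \<tau> \<otimes> inc \<epsilon> \<tau> \<rho> \<oplus> inc \<epsilon> \<sigma> \<tau>' \<otimes> inc \<epsilon> \<tau>' \<rho> = \<zero> \<and>
      (\<forall>t\<in>simplices X (k - 1) - {\<tau>, \<tau>'}. inc \<epsilon> \<sigma> t \<otimes> inc \<epsilon> t \<rho> = \<zero>)"
    using \<tau>' by (intro bexI[of _ ?\<tau>']) (simp_all add: one_plus_one)
qed (auto simp: finite_simplices[OF complex] horizontal_incidence_closed)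

lemma boundary_square_zero:
  assumes c: "c \<in> carrier (Ch k)"
  shows "bd \<epsilon> (k - 1) (bd \<epsilon> k c) = \<zero>\<^bsub>Ch (k - 1 - 1)\<^esub>"
proof (rule ext)
  fix \<rho>
  show "bd \<epsilon> (k - 1) (bd \<epsilon> k c) \<rho> = \<zero>\<^bsub>Ch (k - 1 - 1)\<^esub> \<rho>"
  proof (cases "\<rho> \<in> simplices X (k - 1 - 1)")
    case True
    let ?S = "simplices X k" and ?T = "simplices X (k - 1)"
    note closed = chain_coefficient[OF c] horizontal_incidence_closed
    note fin = finite_simplices[OF complex]
    have ne: "\<rho> \<noteq> {}" using True complex by (auto simp: simplices_def finite_simplicial_complex_def)
    have "bd \<epsilon> (k - 1) (bd \<epsilon> k c) \<rho> = (\<Oplus>\<tau>\<in>?T. bd \<epsilon> k c \<tau> \<otimes> inc \<epsilon> \<tau> \<rho>)"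
      by (rule boundary_coefficient[OF module_homD(1)[OF boundary_hom c] True])
    also have "\<dots> = (\<Oplus>\<tau>\<in>?T. \<Oplus>\<sigma>\<in>?S. c \<sigma> \<otimes> (inc \<epsilon> \<sigma> \<tau> \<otimes> inc \<epsilon> \<tau> \<rho>))"
    proof (rule finsum_cong')
      fix \<tau> assume \<tau>: "\<tau> \<in> ?T"
      have "bd \<epsilon> k c \<tau> \<otimes> inc \<epsilon> \<tau> \<rho> = (\<Oplus>\<sigma>\<in>?S. c \<sigma> \<otimes> inc \<epsilon> \<sigma> \<tau> \<otimes> inc \<epsilon> \<tau> \<rho>)"
        unfolding boundary_coefficient[OF c \<tau>] by (rule finsum_ldistr) (auto simp: fin closed)
      also have "\<dots> = (\<Oplus>\<sigma>\<in>?S. c \<sigma> \<otimes> (inc \<epsilon> \<sigma> \<tau> \<otimes> inc \<epsilon> \<tau> \<rho>))"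
        by (rule finsum_cong') (auto simp: closed m_assoc)
      finally show "bd \<epsilon> k c \<tau> \<otimes> inc \<epsilon> \<tau> \<rho> = \<dots>" .
    qed (auto simp: closed intro!: finsum_closed)
    also have "\<dots> = (\<Oplus>\<sigma>\<in>?S. \<Oplus>\<tau>\<in>?T. c \<sigma> \<otimes> (inc \<epsilon> \<sigma> \<tau> \<otimes> inc \<epsilon> \<tau> \<rho>))"
      by (rule finsum_swap) (auto simp: fin closed)
    also have "\<dots> = \<zero>"
    proof (rule add.finprod_one_eqI)
      fix \<sigma> assume \<sigma>: "\<sigma> \<in> ?S"
      have "(\<Oplus>\<tau>\<in>?T. c \<sigma> \<otimes> (inc \<epsilon> \<sigma> \<tau> \<otimes> inc \<epsilon> \<tau> \<rho>)) = c \<sigma> \<otimes> (\<Oplus>\<tau>\<in>?T. inc \<epsilon> \<sigma> \<tau> \<otimes> inc \<epsilon> \<tau> \<rho>)"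
        by (rule finsum_rdistr[symmetric]) (auto simp: fin closed \<sigma>)
      then show "(\<Oplus>\<tau>\<in>?T. c \<sigma> \<otimes> (inc \<epsilon> \<sigma> \<tau> \<otimes> inc \<epsilon> \<tau> \<rho>)) = \<zero>"
        using incidence_square_zero[OF \<sigma> ne] closed(1)[OF \<sigma>] by simp
    qed
    finally show ?thesis using True by (simp add: chains_ops)
  qed (simp add: boundary_outside chains_ops)
qed

lemma horizontal_complex_at:
  "complex_at R (Ch (k + 1)) (bd \<epsilon> (k + 1)) (Ch k) (bd \<epsilon> k) (Ch (k - 1))"
  using boundary_hom[of \<epsilon> "k + 1"] boundary_hom[of \<epsilon> k] boundary_square_zero[of _ "k + 1" \<epsilon>]
  by (auto simp: complex_at_def intro: chains_module cring_axioms)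


section \<open>The maps induced by recolouring\<close>

abbreviation "fl \<equiv> flip_chain_map R X"

text \<open>Flips are treated for all pairs \<open>\<epsilon> \<le> \<epsilon>'\<close>, not only for those that differ at one vertex: the
  composite of flips along a chain of colourings then is again a flip.\<close>

definition colour_le :: "('v \<Rightarrow> int) \<Rightarrow> ('v \<Rightarrow> int) \<Rightarrow> bool" where
  "colour_le \<epsilon> \<epsilon>' \<longleftrightarrow> (\<forall>u\<in>vertices X. \<epsilon> u \<le> \<epsilon>' u \<and> \<epsilon>' u \<le> 1)"

lemma flip_hom: "fl \<epsilon> \<epsilon>' k \<in> module_hom R (Ch k) (Ch k)"
proof (rule module_homI)
  fix c assume c: "c \<in> carrier (Ch k)"
  show "fl \<epsilon> \<epsilon>' k c \<in> carrier (Ch k)"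
    using chain_coefficient[OF c] by (auto simp: chains_carrier[OF complex] flip_chain_map_def)
qed (auto simp: flip_chain_map_def chains_ops fun_eq_iff)

text \<open>Let \<open>\<tau> = \<sigma> - {u}\<close>. On the left \<open>\<sigma>\<close> contributes to \<open>\<tau>\<close> if \<open>\<epsilon> u = 1\<close> and the colourings agree on
  \<open>\<tau>\<close>, on the right if they agree on all of \<open>\<sigma>\<close> and \<open>\<epsilon>' u = 1\<close>. These conditions are equivalent
  because \<open>\<epsilon> u \<le> \<epsilon>' u \<le> 1\<close>.\<close>

lemma flip_commutes:
  assumes le: "colour_le \<epsilon> \<epsilon>'" and c: "c \<in> carrier (Ch k)"
  shows "fl \<epsilon> \<epsilon>' (k - 1) (bd \<epsilon> k c) = bd \<epsilon>' k (fl \<epsilon> \<epsilon>' k c)"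
proof (rule ext)
  fix \<tau>
  show "fl \<epsilon> \<epsilon>' (k - 1) (bd \<epsilon> k c) \<tau> = bd \<epsilon>' k (fl \<epsilon> \<epsilon>' k c) \<tau>"
  proof (cases "\<tau> \<in> simplices X (k - 1)")
    case True
    note closed = chain_coefficient[OF c] horizontal_incidence_closed
    have le': "\<epsilon> u \<le> \<epsilon>' u" "\<epsilon>' u \<le> 1" if "u \<in> \<sigma>" "\<sigma> \<in> simplices X j" for u \<sigma> j
      using le simplexD[OF that(2)] that(1) by (auto simp: colour_le_def)
    have weights: "weight \<epsilon> \<sigma> = weight \<epsilon>' \<sigma> \<longleftrightarrow> (\<forall>u\<in>\<sigma>. \<epsilon> u = \<epsilon>' u)" if "\<sigma> \<in> simplices X j" for \<sigma> j
      using that simplexD[OF that] le' by (intro weight_eq_iff) auto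
    have entry: "(if weight \<epsilon> \<tau> = weight \<epsilon>' \<tau> then inc \<epsilon> \<sigma> \<tau> else \<zero>)
        = (if weight \<epsilon> \<sigma> = weight \<epsilon>' \<sigma> then inc \<epsilon>' \<sigma> \<tau> else \<zero>)" if \<sigma>: "\<sigma> \<in> simplices X k" for \<sigma>
    proof (cases "\<exists>u\<in>\<sigma>. \<tau> = \<sigma> - {u}")
      case True
      then obtain u where u: "u \<in> \<sigma>" "\<tau> = \<sigma> - {u}" by blast
      then have *: "(\<exists>w\<in>\<sigma>. \<tau> = \<sigma> - {w} \<and> \<delta> w = 1) \<longleftrightarrow> \<delta> u = 1" for \<delta> :: "'v \<Rightarrow> int" by blast
      have "(\<forall>w\<in>\<tau>. \<epsilon> w = \<epsilon>' w) \<and> \<epsilon> u = 1 \<longleftrightarrow> (\<forall>w\<in>\<sigma>. \<epsilon> w = \<epsilon>' w) \<and> \<epsilon>' u = 1"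
        using u le'[OF u(1) \<sigma>] by force
      then show ?thesis
        using simplexD[OF \<sigma>] weights[OF \<sigma>] weights[OF \<open>\<tau> \<in> simplices X (k - 1)\<close>]
        by (auto simp: horizontal_incidence_eq *)
    next
      case False
      then show ?thesis using simplexD[OF \<sigma>] by (auto simp: horizontal_incidence_eq)
    qed
    have "fl \<epsilon> \<epsilon>' (k - 1) (bd \<epsilon> k c) \<tau>
        = (\<Oplus>\<sigma>\<in>simplices X k. c \<sigma> \<otimes> (if weight \<epsilon> \<tau> = weight \<epsilon>' \<tau> then inc \<epsilon> \<sigma> \<tau> else \<zero>))"
      using True by (auto simp: flip_chain_map_def boundary_coefficient[OF c True] closed
          intro!: add.finprod_one_eqI[symmetric])
    also have "\<dots> = (\<Oplus>\<sigma>\<in>simplices X k. fl \<epsilon> \<epsilon>' k c \<sigma> \<otimes> inc \<epsilon>' \<sigma> \<tau>)"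
      by (rule finsum_cong') (auto simp: flip_chain_map_def closed entry)
    also have "\<dots> = bd \<epsilon>' k (fl \<epsilon> \<epsilon>' k c) \<tau>"
      by (rule boundary_coefficient[OF module_homD(1)[OF flip_hom c] True, symmetric])
    finally show ?thesis .
  qed (simp add: boundary_outside flip_chain_map_def)
qed

abbreviation "bds \<epsilon> k \<equiv> boundaries (Ch (k + 1)) (bd \<epsilon> (k + 1))"
abbreviation "cyc \<epsilon> k \<equiv> cycles (Ch k) (bd \<epsilon> k) (Ch (k - 1))"
abbreviation "HH \<equiv> horizontal_homology R X v"
abbreviation "flm \<equiv> flip_map R X v"

lemma flip_boundaries: "colour_le \<epsilon> \<epsilon>' \<Longrightarrow> fl \<epsilon> \<epsilon>' k ` bds \<epsilon> k \<subseteq> bds \<epsilon>' k"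
  using flip_commutes[of \<epsilon> \<epsilon>' _ "k + 1"] module_homD(1)[OF flip_hom] by fastforce

lemma flip_cycles:
  assumes "colour_le \<epsilon> \<epsilon>'"
  shows "fl \<epsilon> \<epsilon>' k ` cyc \<epsilon> k \<subseteq> cyc \<epsilon>' k"
  using flip_commutes[OF assms, of _ k] module_homD(1)[OF flip_hom]
    module_hom_zero[OF chains_module chains_module flip_hom, OF cring_axioms cring_axioms]
  by fastforce

lemma horizontal_homology_deg_module: "module R (horizontal_homology_deg R X v \<epsilon> k)"
  unfolding horizontal_homology_deg_def by (rule homology_module[OF horizontal_complex_at])

lemma horizontal_homology_deg_zero: "\<zero>\<^bsub>horizontal_homology_deg R X v \<epsilon> k\<^esub> = bds \<epsilon> k"
  by (simp add: horizontal_homology_deg_def homology_at_def quotient_module_def)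

lemma horizontal_homology_module: "module R (HH \<epsilon>)"
  unfolding horizontal_homology_def
  by (rule direct_sum_module) (rule cring_axioms horizontal_homology_deg_module)+

lemma flip_map_eq: "flm \<epsilon> \<epsilon>' x = (\<lambda>k\<in>UNIV. induced_map (bds \<epsilon>' k) (Ch k) (fl \<epsilon> \<epsilon>' k) (x k))"
  by (simp add: flip_map_def induced_map_def restrict_def horizontal_homology_deg_zero)

lemma flip_map_hom:
  assumes "colour_le \<epsilon> \<epsilon>'"
  shows "flm \<epsilon> \<epsilon>' \<in> module_hom R (HH \<epsilon>) (HH \<epsilon>')"
proof -
  have "induced_map (bds \<epsilon>' k) (Ch k) (fl \<epsilon> \<epsilon>' k)
      \<in> module_hom R (horizontal_homology_deg R X v \<epsilon> k) (horizontal_homology_deg R X v \<epsilon>' k)" for k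
    unfolding horizontal_homology_deg_def
    by (rule induced_map_homology_hom[OF horizontal_complex_at horizontal_complex_at flip_hom
          flip_boundaries[OF assms] flip_cycles[OF assms]])
  then have "(\<lambda>x. \<lambda>k\<in>UNIV. induced_map (bds \<epsilon>' k) (Ch k) (fl \<epsilon> \<epsilon>' k) (x k)) \<in> module_hom R (HH \<epsilon>) (HH \<epsilon>')"
    unfolding horizontal_homology_def
    by (intro direct_sum_map_hom horizontal_homology_deg_module)
  then show ?thesis unfolding flip_map_eq[abs_def] .
qed

lemma horizontal_class:
  assumes "x \<in> carrier (HH \<epsilon>)"
  obtains z where "z \<in> cyc \<epsilon> k" "x k = bds \<epsilon> k +>\<^bsub>Ch k\<^esub> z"
  using direct_sum_component[of x UNIV "horizontal_homology_deg R X v \<epsilon>" k] assms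
    homology_carrier[OF horizontal_complex_at]
  by (auto simp: horizontal_homology_def horizontal_homology_deg_def)

lemma flip_coset:
  assumes "colour_le \<epsilon> \<epsilon>'" "z \<in> carrier (Ch k)"
  shows "induced_map (bds \<epsilon>' k) (Ch k) (fl \<epsilon> \<epsilon>' k) (bds \<epsilon> k +>\<^bsub>Ch k\<^esub> z)
    = bds \<epsilon>' k +>\<^bsub>Ch k\<^esub> fl \<epsilon> \<epsilon>' k z"
  by (rule induced_map_coset[OF _ boundaries_submodule[OF horizontal_complex_at] _
        boundaries_submodule[OF horizontal_complex_at] flip_hom flip_boundaries])
    (use assms chains_module[OF cring_axioms] in auto)

lemma flip_map_refl:
  assumes "colour_le \<epsilon> \<epsilon>" "x \<in> carrier (HH \<epsilon>)"
  shows "flm \<epsilon> \<epsilon> x = x"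
proof (rule ext)
  fix k
  obtain z where z: "z \<in> cyc \<epsilon> k" "x k = bds \<epsilon> k +>\<^bsub>Ch k\<^esub> z"
    using horizontal_class[OF assms(2)] .
  have "fl \<epsilon> \<epsilon> k z = z"
    using z(1) PiE_restrict[of z "simplices X k" "\<lambda>_. carrier R"]
    by (simp add: flip_chain_map_def chains_carrier[OF complex])
  then show "flm \<epsilon> \<epsilon> x k = x k"
    using z flip_coset[OF assms(1)] by (simp add: flip_map_eq)
qed

lemma flip_map_trans:
  assumes le: "colour_le \<epsilon> \<epsilon>'" "colour_le \<epsilon>' \<epsilon>''" and x: "x \<in> carrier (HH \<epsilon>)"
  shows "flm \<epsilon>' \<epsilon>'' (flm \<epsilon> \<epsilon>' x) = flm \<epsilon> \<epsilon>'' x"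
proof (rule ext)
  fix k
  have le': "colour_le \<epsilon> \<epsilon>''" using le by (fastforce simp: colour_le_def)
  obtain z where z: "z \<in> cyc \<epsilon> k" "x k = bds \<epsilon> k +>\<^bsub>Ch k\<^esub> z"
    using horizontal_class[OF x] .
  \<comment> \<open>Recolouring only lowers the weight, so it is constant from \<open>\<epsilon>\<close> to \<open>\<epsilon>''\<close> iff it is constant on
    both parts of the way.\<close>
  have "weight \<epsilon> \<sigma> = weight \<epsilon>'' \<sigma> \<longleftrightarrow> weight \<epsilon> \<sigma> = weight \<epsilon>' \<sigma> \<and> weight \<epsilon>' \<sigma> = weight \<epsilon>'' \<sigma>"
    if \<sigma>: "\<sigma> \<in> simplices X k" for \<sigma>
  proof -
    have "weight \<epsilon>' \<sigma> \<le> weight \<epsilon> \<sigma>" "weight \<epsilon>'' \<sigma> \<le> weight \<epsilon>' \<sigma>"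
      using le simplexD[OF \<sigma>] by (auto simp: colour_le_def intro!: weight_antimono)
    then show ?thesis by linarith
  qed
  then have "fl \<epsilon>' \<epsilon>'' k (fl \<epsilon> \<epsilon>' k z) = fl \<epsilon> \<epsilon>'' k z"
    by (auto simp: flip_chain_map_def fun_eq_iff)
  then show "flm \<epsilon>' \<epsilon>'' (flm \<epsilon> \<epsilon>' x) k = flm \<epsilon> \<epsilon>'' x k"
    using z flip_coset[OF le(1)] flip_coset[OF le(2)] flip_coset[OF le'] module_homD(1)[OF flip_hom]
    by (simp add: flip_map_eq)
qed


section \<open>The functor on the Boolean poset\<close>

abbreviation "col \<equiv> subset_colouring X v"

lemma colour_le_subset: "b \<subseteq> b' \<Longrightarrow> colour_le (col b) (col b')"
  by (auto simp: colour_le_def subset_colouring_def)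

lemma H_chain_eq_flip:
  "x \<in> carrier (HH (col b)) \<Longrightarrow> H_chain R X v is b x = flm (col b) (col (b \<union> set is)) x"
proof (induct "is" arbitrary: b x)
  case Nil
  then show ?case using flip_map_refl[OF colour_le_subset[of b b]] by simp
next
  case (Cons i "is")
  have "flm (col b) (col (insert i b)) x \<in> carrier (HH (col (insert i b)))"
    by (rule module_homD(1)[OF flip_map_hom[OF colour_le_subset] Cons.prems]) auto
  then have "H_chain R X v (i # is) b x
      = flm (col (insert i b)) (col (insert i b \<union> set is)) (flm (col b) (col (insert i b)) x)"
    using Cons.hyps by simp
  also have "\<dots> = flm (col b) (col (insert i b \<union> set is)) x"
    by (rule flip_map_trans[OF colour_le_subset colour_le_subset Cons.prems]) auto
  finally show ?case by simp
qed

text \<open>The right-hand side does not refer to a saturated chain; this is what makes the extension to all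
  morphisms functorial.\<close>

lemma H_mor_eq_flip:
  assumes "(b, b') \<in> boolean_le m" "x \<in> carrier (H_obj R X v b)"
  shows "H_mor R X v b b' x = flm (col b) (col b') x"
proof -
  have "finite (b' - b)" "b \<union> (b' - b) = b'"
    using assms(1) finite_subset[of b' "{1..m}"] by (auto simp: boolean_le_def)
  then show ?thesis
    using H_chain_eq_flip[of x b "sorted_list_of_set (b' - b)"] assms(2)
    by (simp add: H_mor_def H_obj_def)
qed

lemma H_functor:
  "functor_to_modules R (boolean_elems m) (boolean_le m) (H_obj R X v) (H_mor R X v)"
proof -
  note le = colour_le_subset
  have hom: "H_mor R X v b b' \<in> module_hom R (H_obj R X v b) (H_obj R X v b')"
    if "(b, b') \<in> boolean_le m" for b b'
  proof (rule module_hom_cong[rotated])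
    show "flm (col b) (col b') \<in> module_hom R (H_obj R X v b) (H_obj R X v b')"
      unfolding H_obj_def using that by (intro flip_map_hom le) (auto simp: boolean_le_def)
  qed (use H_mor_eq_flip[OF that] horizontal_homology_module in \<open>auto simp: H_obj_def\<close>)
  have comp: "H_mor R X v b b'' x = H_mor R X v b' b'' (H_mor R X v b b' x)"
    if b: "(b, b') \<in> boolean_le m" "(b', b'') \<in> boolean_le m" and x: "x \<in> carrier (H_obj R X v b)"
    for b b' b'' x
  proof -
    have b'': "(b, b'') \<in> boolean_le m" using b by (auto simp: boolean_le_def)
    have "H_mor R X v b' b'' (H_mor R X v b b' x) = flm (col b') (col b'') (flm (col b) (col b') x)"
      using H_mor_eq_flip[OF b(1) x] H_mor_eq_flip[OF b(2)] module_homD(1)[OF hom[OF b(1)] x] by simp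
    also have "\<dots> = flm (col b) (col b'') x"
      using b x by (intro flip_map_trans le) (auto simp: boolean_le_def H_obj_def)
    finally show ?thesis using H_mor_eq_flip[OF b'' x] by simp
  qed
  show ?thesis
    unfolding functor_to_modules_def
    using hom comp horizontal_homology_module by (auto simp: H_obj_def H_mor_def)
qed

end


section \<open>Bi-colourings as subsets\<close>

text \<open>The inverse of \<^const>\<open>subset_colouring\<close>. The comparison of complexes is indexed by this direction,
  since a cochain indexed by subsets becomes one indexed by colourings by composition with it.\<close>

definition colour_support :: "(nat \<Rightarrow> 'v) \<Rightarrow> nat \<Rightarrow> ('v \<Rightarrow> int) \<Rightarrow> nat set" where
  "colour_support v m \<epsilon> = {i \<in> {1..m}. \<epsilon> (v i) = 1}"

locale enumerated_complex = horizontal_complex R X v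
  for R (structure) and X :: "'v set set" and v :: "nat \<Rightarrow> 'v" +
  fixes m :: nat
  assumes card_vertices: "card (vertices X) = m" and enum: "bij_betw v {1..m} (vertices X)"
begin

abbreviation "supp \<equiv> colour_support v m"

lemma vertex_cases:
  assumes "u \<in> vertices X"
  obtains i where "i \<in> {1..m}" "u = v i"
  using assms enum by (metis bij_betw_imp_surj_on imageE)

lemma enum_vertex: "i \<in> {1..m} \<Longrightarrow> v i \<in> vertices X"
  using enum by (auto simp: bij_betw_def)

lemma enum_eq_iff: "i \<in> {1..m} \<Longrightarrow> j \<in> {1..m} \<Longrightarrow> v i = v j \<longleftrightarrow> i = j"
  by (rule inj_on_eq_iff[OF bij_betw_imp_inj_on[OF enum]])

lemma vertex_index_enum: "i \<in> {1..m} \<Longrightarrow> vertex_index X v (v i) = i"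
  unfolding vertex_index_def card_vertices
  by (rule inv_into_f_f[OF bij_betw_imp_inj_on[OF enum]])

lemma col_enum: "i \<in> {1..m} \<Longrightarrow> col b (v i) = (if i \<in> b then 1 else 0)"
  by (simp add: subset_colouring_def enum_vertex vertex_index_enum)

lemma col_bicolouring: "col b \<in> bicolourings X"
  by (auto simp: subset_colouring_def bicolourings_def)

lemma support_col: "b \<subseteq> {1..m} \<Longrightarrow> supp (col b) = b"
  by (auto simp: colour_support_def col_enum split: if_splits)

lemma bicolouring_eqI:
  assumes "\<epsilon> \<in> bicolourings X" "\<epsilon>' \<in> bicolourings X" "\<And>i. i \<in> {1..m} \<Longrightarrow> \<epsilon> (v i) = \<epsilon>' (v i)"
  shows "\<epsilon> = \<epsilon>'"
  by (rule PiE_ext[OF assms(1,2)[unfolded bicolourings_def]]) (metis vertex_cases assms(3))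

lemma bicolouring_values: "\<epsilon> \<in> bicolourings X \<Longrightarrow> i \<in> {1..m} \<Longrightarrow> \<epsilon> (v i) = 0 \<or> \<epsilon> (v i) = 1"
  using enum_vertex[of i] by (auto simp: bicolourings_def)

lemma col_support: "\<epsilon> \<in> bicolourings X \<Longrightarrow> col (supp \<epsilon>) = \<epsilon>"
  using bicolouring_values[of \<epsilon>]
  by (intro bicolouring_eqI col_bicolouring) (auto simp: col_enum colour_support_def)

lemma support_subset: "supp \<epsilon> \<subseteq> {1..m}"
  by (auto simp: colour_support_def)

lemma support_bij: "bij_betw supp (bicolourings X) (boolean_elems m)"
  by (rule bij_betw_byWitness[where f' = col])
    (use support_subset in \<open>auto simp: support_col col_support col_bicolouring boolean_elems_def\<close>)

lemma support_rank:
  assumes "\<epsilon> \<in> bicolourings X"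
  shows "boolean_rank (supp \<epsilon>) = colour_length X \<epsilon>"
proof -
  have "colour_length X \<epsilon> = (\<Sum>i\<in>{1..m}. \<epsilon> (v i))"
    unfolding colour_length_def by (rule sum.reindex_bij_betw[OF enum, symmetric])
  also have "\<dots> = (\<Sum>i\<in>{1..m}. if \<epsilon> (v i) = 1 then 1 else 0)"
    using bicolouring_values[OF assms] by (intro sum.cong) auto
  also have "\<dots> = boolean_rank (supp \<epsilon>)"
  proof -
    have "supp \<epsilon> = {1..m} \<inter> {i. \<epsilon> (v i) = 1}" by (auto simp: colour_support_def)
    then show ?thesis by (simp add: boolean_rank_def sum.If_cases)
  qed
  finally show ?thesis by simp
qed

lemma support_covers:
  assumes "\<epsilon> \<in> bicolourings X" "\<epsilon>' \<in> bicolourings X"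
  shows "covers (boolean_elems m) (boolean_le m) (supp \<epsilon>) (supp \<epsilon>') \<longleftrightarrow> colour_flip X \<epsilon> \<epsilon>'"
proof
  assume "covers (boolean_elems m) (boolean_le m) (supp \<epsilon>) (supp \<epsilon>')"
  then obtain i where i: "i \<notin> supp \<epsilon>" "supp \<epsilon>' = insert i (supp \<epsilon>)" "i \<in> {1..m}"
    by (auto simp: covers_boolean_iff)
  have zero: "\<epsilon> (v i) = 0"
    using i bicolouring_values[OF assms(1), of i] by (auto simp: colour_support_def)
  have "\<epsilon>(v i := 1) \<in> bicolourings X"
    using assms(1) enum_vertex[OF i(3)] PiE_fun_upd[of 1 "\<lambda>_. {0, 1}" "v i" \<epsilon> "vertices X"]
    by (simp add: bicolourings_def insert_absorb)
  moreover have "\<epsilon>' (v j) = (\<epsilon>(v i := 1)) (v j)" if j: "j \<in> {1..m}" for j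
    using col_enum[OF j, of "supp \<epsilon>", unfolded col_support[OF assms(1)]]
      col_enum[OF j, of "supp \<epsilon>'", unfolded col_support[OF assms(2)]] enum_eq_iff[OF j i(3)]
    unfolding i(2) by simp
  ultimately have "\<epsilon>' = \<epsilon>(v i := 1)"
    by (intro bicolouring_eqI assms(2)) auto
  with zero show "colour_flip X \<epsilon> \<epsilon>'"
    using enum_vertex[OF i(3)] by (auto simp: colour_flip_def)
next
  assume "colour_flip X \<epsilon> \<epsilon>'"
  then obtain u where "u \<in> vertices X" and u: "\<epsilon> u = 0" "\<epsilon>' = \<epsilon>(u := 1)"
    by (auto simp: colour_flip_def)
  then obtain i where i: "i \<in> {1..m}" "u = v i" by (auto elim: vertex_cases)
  have "supp \<epsilon>' = insert i (supp \<epsilon>)"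
    using u i enum_eq_iff[OF _ i(1)] by (auto simp: colour_support_def)
  moreover have "i \<notin> supp \<epsilon>"
    using u i by (simp add: colour_support_def)
  ultimately show "covers (boolean_elems m) (boolean_le m) (supp \<epsilon>) (supp \<epsilon>')"
    using support_subset[of \<epsilon>'] by (auto simp: covers_boolean_iff)
qed

lemma H_obj_support: "\<epsilon> \<in> bicolourings X \<Longrightarrow> H_obj R X v (supp \<epsilon>) = HH \<epsilon>"
  by (simp add: H_obj_def col_support)

lemma sign_scalar_one: "sign_scalar R t = \<one>"
  by (simp add: sign_scalar_def minus_one)


section \<open>Comparison of the two complexes\<close>

abbreviation "B \<equiv> boolean_elems m"
abbreviation "B_le \<equiv> boolean_le m"
abbreviation "colourings_of_length n \<equiv> {\<epsilon> \<in> bicolourings X. colour_length X \<epsilon> = n}"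
abbreviation "PC \<equiv> poset_cochains B boolean_rank (H_obj R X v)"

definition reindex :: "int \<Rightarrow> (nat set \<Rightarrow> 'z) \<Rightarrow> ('v \<Rightarrow> int) \<Rightarrow> 'z" where
  "reindex n a = (\<lambda>\<epsilon> \<in> colourings_of_length n. a (supp \<epsilon>))"

lemma support_bij_length: "bij_betw supp (colourings_of_length n) {b \<in> B. boolean_rank b = n}"
proof (rule bij_betw_imageI)
  show "inj_on supp (colourings_of_length n)"
    using bij_betw_imp_inj_on[OF support_bij] by (rule inj_on_subset) auto
  show "supp ` colourings_of_length n = {b \<in> B. boolean_rank b = n}"
    unfolding bij_betw_imp_surj_on[OF support_bij, symmetric] by (auto simp: support_rank)
qed

lemma reindex_iso:
  "reindex n \<in> module_hom R (PC n) (ueber_cochains R X v n)"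
  "bij_betw (reindex n) (carrier (PC n)) (carrier (ueber_cochains R X v n))"
proof -
  note iso = direct_sum_reindex[OF support_bij_length, of n "HH" "H_obj R X v"]
  show "reindex n \<in> module_hom R (PC n) (ueber_cochains R X v n)"
    unfolding reindex_def[abs_def] poset_cochains_def ueber_cochains_def
    by (rule iso(1)) (simp add: H_obj_support)
  show "bij_betw (reindex n) (carrier (PC n)) (carrier (ueber_cochains R X v n))"
    unfolding reindex_def[abs_def] poset_cochains_def ueber_cochains_def
    by (rule iso(2)) (simp add: H_obj_support)
qed

text \<open>The signs disappear in characteristic two, and on a covering relation the functor is the flip
  map by definition; hence the two differentials have the same summands.\<close>

lemma reindex_differential:
  assumes a: "a \<in> carrier (PC n)"
  shows "ueber_differential R X v n (reindex n a)
    = reindex (n + 1) (poset_differential R B B_le boolean_rank s (H_obj R X v) (H_mor R X v) n a)"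
proof (rule ext)
  fix \<epsilon>'
  let ?d = "poset_differential R B B_le boolean_rank s (H_obj R X v) (H_mor R X v) n a"
  show "ueber_differential R X v n (reindex n a) \<epsilon>' = reindex (n + 1) ?d \<epsilon>'"
  proof (cases "\<epsilon>' \<in> colourings_of_length (n + 1)")
    case True
    then have \<epsilon>': "\<epsilon>' \<in> bicolourings X" "colour_length X \<epsilon>' = n + 1" by auto
    interpret H: module R "HH \<epsilon>'" by (rule horizontal_homology_module)
    let ?S = "{\<epsilon> \<in> bicolourings X. colour_length X \<epsilon> = n \<and> colour_flip X \<epsilon> \<epsilon>'}"
    let ?f = "\<lambda>b. sign_scalar R (s b (supp \<epsilon>')) \<odot>\<^bsub>HH \<epsilon>'\<^esub> H_mor R X v b (supp \<epsilon>') (a b)"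
    have image: "{b \<in> B. boolean_rank b = n \<and> covers B B_le b (supp \<epsilon>')} = supp ` ?S" (is "?T = _")
    proof
      show "supp ` ?S \<subseteq> ?T"
        using support_rank support_covers[OF _ \<epsilon>'(1)] support_subset by (auto simp: boolean_elems_def)
      show "?T \<subseteq> supp ` ?S"
      proof
        fix b assume b: "b \<in> ?T"
        then have eq: "supp (col b) = b" by (intro support_col) (auto simp: boolean_elems_def)
        have "col b \<in> ?S"
          using b eq col_bicolouring support_rank[OF col_bicolouring[of b]]
            support_covers[OF col_bicolouring[of b] \<epsilon>'(1)] by auto
        then have "supp (col b) \<in> supp ` ?S" by (rule imageI)
        then show "b \<in> supp ` ?S" unfolding eq .
      qed
    qed
    have term_eq: "?f (supp \<epsilon>) = flm \<epsilon> \<epsilon>' (reindex n a \<epsilon>) \<and> ?f (supp \<epsilon>) \<in> carrier (HH \<epsilon>')"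
      if "\<epsilon> \<in> ?S" for \<epsilon>
    proof -
      have \<epsilon>: "\<epsilon> \<in> bicolourings X" "colour_length X \<epsilon> = n" "colour_flip X \<epsilon> \<epsilon>'" using that by auto
      have cov: "covers B B_le (supp \<epsilon>) (supp \<epsilon>')"
        using support_covers[OF \<epsilon>(1) \<epsilon>'(1)] \<epsilon>(3) by simp
      have "supp \<epsilon> \<in> {b \<in> B. boolean_rank b = n}"
        using support_rank[OF \<epsilon>(1)] \<epsilon>(2) support_subset[of \<epsilon>] by (simp add: boolean_elems_def)
      then have "a (supp \<epsilon>) \<in> carrier (H_obj R X v (supp \<epsilon>))"
        using direct_sum_component[of a "{b \<in> B. boolean_rank b = n}" "H_obj R X v" "supp \<epsilon>"] a
        by (simp add: poset_cochains_def)
      then have aH: "a (supp \<epsilon>) \<in> carrier (HH \<epsilon>)" by (simp add: H_obj_support[OF \<epsilon>(1)])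
      have "supp \<epsilon> \<subseteq> supp \<epsilon>'"
        using covers_in_poset[OF cov] by (simp add: boolean_le_def)
      then have "colour_le \<epsilon> \<epsilon>'"
        using colour_le_subset col_support[OF \<epsilon>(1)] col_support[OF \<epsilon>'(1)] by metis
      then have "flm \<epsilon> \<epsilon>' (a (supp \<epsilon>)) \<in> carrier (HH \<epsilon>')"
        using module_homD(1)[OF flip_map_hom aH] by blast
      then show ?thesis
        using \<epsilon> by (simp add: sign_scalar_one H_mor_covers[OF cov] col_support \<epsilon>'(1) reindex_def)
    qed
    have "reindex (n + 1) ?d \<epsilon>' = ?d (supp \<epsilon>')"
      using True by (simp add: reindex_def)
    also have "\<dots> = (\<Oplus>\<^bsub>HH \<epsilon>'\<^esub>b\<in>?T. ?f b)"
      using support_rank[OF \<epsilon>'(1)] \<epsilon>'(2) support_subset[of \<epsilon>']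
      by (simp add: poset_differential_def H_obj_support[OF \<epsilon>'(1)] boolean_elems_def)
    also have "\<dots> = (\<Oplus>\<^bsub>HH \<epsilon>'\<^esub>b\<in>supp ` ?S. ?f b)"
      unfolding image ..
    also have "\<dots> = (\<Oplus>\<^bsub>HH \<epsilon>'\<^esub>\<epsilon>\<in>?S. ?f (supp \<epsilon>))"
      using support_bij term_eq
      by (intro H.add.finprod_reindex) (auto simp: bij_betw_def intro: inj_on_subset)
    also have "\<dots> = (\<Oplus>\<^bsub>HH \<epsilon>'\<^esub>\<epsilon>\<in>?S. flm \<epsilon> \<epsilon>' (reindex n a \<epsilon>))"
    proof (rule H.finsum_cong')
      show "(\<lambda>\<epsilon>. flm \<epsilon> \<epsilon>' (reindex n a \<epsilon>)) \<in> ?S \<rightarrow> carrier (HH \<epsilon>')"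
        using term_eq by (metis (no_types, lifting) Pi_I)
    qed (use term_eq in auto)
    finally show ?thesis using True by (simp add: ueber_differential_def)
  qed (auto simp: ueber_differential_def reindex_def)
qed

lemma poset_homology_isomorphic_ueberhomology:
  assumes "sign_assignment B B_le s"
  shows "module_isomorphic R
    (poset_homology R B B_le boolean_rank s (H_obj R X v) (H_mor R X v) n) (ueberhomology R X v n)"
proof -
  have U: "module R (ueber_cochains R X v j)" for j
    unfolding ueber_cochains_def
    by (rule direct_sum_module) (rule cring_axioms horizontal_homology_module)+
  show ?thesis
    unfolding poset_homology_def ueberhomology_def
  proof (rule homology_isomorphic)
    show "complex_at R (PC (n - 1))
        (poset_differential R B B_le boolean_rank s (H_obj R X v) (H_mor R X v) (n - 1)) (PC n)
        (poset_differential R B B_le boolean_rank s (H_obj R X v) (H_mor R X v) n) (PC (n + 1))"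
      by (rule poset_complex_at[OF cring_axioms squared_poset_boolean assms H_functor])
    show "ueber_differential R X v (n - 1) (reindex (n - 1) x)
        = reindex n (poset_differential R B B_le boolean_rank s (H_obj R X v) (H_mor R X v) (n - 1) x)"
      if "x \<in> carrier (PC (n - 1))" for x
      using reindex_differential[OF that] by simp
  qed (rule reindex_iso reindex_differential U | assumption)+
qed

end

lemma field_of_two_elements:
  assumes "field F" "card (carrier F) = 2"
  shows "cring_char_two F"
proof -
  interpret field F by fact
  have "{\<zero>\<^bsub>F\<^esub>, \<one>\<^bsub>F\<^esub>} = carrier F"
    using assms(2) zero_not_one by (intro card_seteq) (auto intro: card_ge_0_finite)
  moreover have "\<one>\<^bsub>F\<^esub> \<oplus>\<^bsub>F\<^esub> \<one>\<^bsub>F\<^esub> \<noteq> \<one>\<^bsub>F\<^esub>"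
    using zero_not_one by simp
  ultimately have "\<one>\<^bsub>F\<^esub> \<oplus>\<^bsub>F\<^esub> \<one>\<^bsub>F\<^esub> = \<zero>\<^bsub>F\<^esub>"
    using a_closed[OF one_closed one_closed] by blast
  then show ?thesis by unfold_locales
qed

theorem proposition2p14:
  fixes F :: "('f, 'x) ring_scheme"
    and X :: "'v set set"
    and m :: nat
    and v :: "nat \<Rightarrow> 'v"
    and s :: "nat set \<Rightarrow> nat set \<Rightarrow> bit"
  assumes "field F" and "card (carrier F) = 2"
    and "finite_simplicial_complex X" and "connected_complex X"
    and "card (vertices X) = m"
    and "bij_betw v {1..m} (vertices X)"
    and "sign_assignment (boolean_elems m) (boolean_le m) s"
  shows "functor_to_modules F (boolean_elems m) (boolean_le m) (H_obj F X v) (H_mor F X v) \<and>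
    (\<forall>n. module_isomorphic F
      (poset_homology F (boolean_elems m) (boolean_le m) boolean_rank s (H_obj F X v) (H_mor F X v) n)
      (ueberhomology F X v n))"
proof -
  interpret cring_char_two F by (rule field_of_two_elements) fact+
  interpret enumerated_complex F X v m by unfold_locales fact+
  show ?thesis
    using H_functor poset_homology_isomorphic_ueberhomology[OF assms(7)] by blast
qed

end
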